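(* There exists a polynomial $P$ with nonnegative coefficients (universal, i.e. not depending on the problem instance, $d$ or $T$) such that the following holds. Let $T>2$ and $d\ge1$. Consider the constrained online convex optimization problem on the probability simplex described in the context, satisfying the boundedness/smoothness assumptions and Slater's condition with constant $\varsigma>0$. Run the online primal-dual mirror-prox algorithm on the probability simplex (described in the context) with $$\eta=[V_\infty(T)+L_f^2+1]^{-1/2},\quad \gamma=[V_\infty(T)+L_f^2+1]^{1/4},\quad \nu=1/T,$$ $$\alpha_0=0,\qquad \alpha_t=\max\big\{3(\eta L_f^2+\gamma^2L_gG)+2/\eta+3\xi_t,\ \alpha_{t-1}\big\}\quad(t\ge1),$$ where $\xi_t=\gamma L_g\|\mathbf Q(t)\|_1+\gamma^2(L_gG+H^2)$. Then for every $k\in[K]$, $$\mathrm{Violation}(T,k):=\sum_{t=1}^Tg_k(\mathbf x_t)\le P(H,F,G,L_f,L_g,K,1/\varsigma)\,(1+\log d)\,\log T.$$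
   Context: Notation. $d,K\ge1$ are integers; $\Delta=\{\mathbf x\in\mathbb R^d:\|\mathbf x\|_1=1,\ \mathbf x_i\ge0\ \forall i\}$ is the probability simplex; $\boldsymbol 1\in\mathbb R^d$ is the all-ones vector; $D_{\mathrm{KL}}(\mathbf x,\mathbf y)=\sum_{i=1}^d\mathbf x_i\log(\mathbf x_i/\mathbf y_i)$ (with $0\log0=0$) for $\mathbf x\in\Delta$ and $\mathbf y$ in the relative interior of $\Delta$; $[K]=\{1,\dots,K\}$. Problem. The losses $f^t:\Delta\to\mathbb R$, $t=0,1,2,\dots$, are convex and differentiable ($f^t$ is revealed after $\mathbf x_t$ is chosen; $f^0$ is used only for initialization). The constraint functions $g_k$, $k\in[K]$, are convex and differentiable on $\Delta$; $\mathbf g=[g_1,\dots,g_K]^\top$. $$V_\infty(T)=\sum_{t=1}^T\max_{\mathbf x\in\Delta}\|\nabla f^t(\mathbf x)-\nabla f^{t-1}(\mathbf x)\|_\infty^2.$$ Boundedness/smoothness assumptions. For all $\mathbf x,\mathbf y\in\Delta$, $t\ge0$, $k\in[K]$: $\|\nabla f^t(\mathbf x)\|_\infty\le F$; $\|\nabla f^t(\mathbf x)-\nabla f^t(\mathbf y)\|_\infty\le L_f\|\mathbf x-\mathbf y\|_1$; $\sum_{k=1}^K|g_k(\mathbf x)|\le G$; $|g_k(\mathbf x)-g_k(\mathbf y)|\le H_k\|\mathbf x-\mathbf y\|_1$, with $H:=\sum_{k=1}^KH_k$; $\|\nabla g_k(\mathbf x)-\nabla g_k(\mathbf y)\|_\infty\le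 L_g\|\mathbf x-\mathbf y\|_1$. Slater's condition. There are $\varsigma>0$ and $\breve{\mathbf x}\in\Delta$ with $g_k(\breve{\mathbf x})\le-\varsigma$ for all $k\in[K]$. Online primal-dual mirror-prox algorithm on the probability simplex (parameters $\gamma>0$, $\nu\in(0,1]$, $\alpha_t>0$). Initialize $\mathbf x_0=\tilde{\mathbf x}_1=\boldsymbol 1/d$, $Q_k(0)=0$. For $t=1,2,\dots$: (1) $\tilde{\mathbf y}_t=(1-\nu)\tilde{\mathbf x}_t+\frac{\nu}{d}\boldsymbol 1$; (2) $Q_k(t)=\max\{-\gamma g_k(\mathbf x_{t-1}),\ Q_k(t-1)+\gamma g_k(\mathbf x_{t-1})\}$ for $k\in[K]$, and $\mathbf Q(t)=[Q_1(t),\dots,Q_K(t)]^\top$; (3) $\mathbf x_t=\arg\min_{\mathbf x\in\Delta}\langle\nabla f^{t-1}(\mathbf x_{t-1}),\mathbf x\rangle+\sum_{k=1}^K[Q_k(t)+\gamma g_k(\mathbf x_{t-1})]\langle\gamma\nabla g_k(\mathbf x_{t-1}),\mathbf x\rangle+\alpha_tD_{\mathrm{KL}}(\mathbf x,\tilde{\mathbf y}_t)$; (4) play $\mathbf x_t$, observe $f^t$; (5) $\tilde{\mathbf x}_{t+1}=\arg\min_{\mathbf x\in\Delta}\langle\nabla f^t(\mathbf x_t),\mathbf x\rangle+\sum_{k=1}^K[Q_k(t)+\gamma g_k(\mathbf x_{t-1})]\langle\gamma\nabla g_k(\mathbf x_{t-1}),\mathbf x\rangle+\alpha_tD_{\mathrm{KL}}(\mathbf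 x,\tilde{\mathbf y}_t)$. *)

theory Defs
  imports Complex_Main "HOL-Library.Poly_Mapping" "Jordan_Normal_Form.Matrix"
begin

text \<open>The dimension is quantified inside the main statement (after the universal polynomial), so it
  cannot be a type: points of \<open>\<real>\<^sup>d\<close> are elements of \<open>carrier_vec d\<close>, with coordinates
  indexed from 0 to \<open>d - 1\<close>.\<close>

definition norm1 :: "real vec \<Rightarrow> real" where
  "norm1 x = (\<Sum>i<dim_vec x. \<bar>x $ i\<bar>)"

definition norm_inf :: "real vec \<Rightarrow> real" where
  "norm_inf x = Max ((\<lambda>i. \<bar>x $ i\<bar>) ` {..<dim_vec x})"

definition simplex :: "nat \<Rightarrow> real vec set" where
  "simplex d = {x \<in> carrier_vec d. norm1 x = 1 \<and> (\<forall>i<d. 0 \<le> x $ i)}"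

definition ones :: "nat \<Rightarrow> real vec" where
  "ones d = vec d (\<lambda>_. 1)"

text \<open>The convention \<open>0 log 0 = 0\<close> is automatic, because the factor \<open>x $ i\<close> vanishes.\<close>

definition KL :: "real vec \<Rightarrow> real vec \<Rightarrow> real" where
  "KL x y = (\<Sum>i<dim_vec x. x $ i * ln (x $ i / y $ i))"

definition convex_fun_on :: "real vec set \<Rightarrow> (real vec \<Rightarrow> real) \<Rightarrow> bool" where
  "convex_fun_on S \<phi> \<longleftrightarrow> (\<forall>x\<in>S. \<forall>y\<in>S. \<forall>u\<in>{0..1}.
     \<phi> ((1 - u) \<cdot>\<^sub>v x + u \<cdot>\<^sub>v y) \<le> (1 - u) * \<phi> x + u * \<phi> y)"

text \<open>Frechet differentiability relative to \<open>S\<close>, with the derivative represented by the vector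
  \<open>p\<close>. On the simplex, \<open>p\<close> is unique only up to multiples of the all-ones vector; the gradient
  fields below are therefore data of the problem, subject to this condition. If the function is
  differentiable on a neighbourhood of the simplex, its usual gradient is one of them.\<close>

definition has_gradient_on ::
    "real vec set \<Rightarrow> (real vec \<Rightarrow> real) \<Rightarrow> real vec \<Rightarrow> real vec \<Rightarrow> bool" where
  "has_gradient_on S \<phi> x p \<longleftrightarrow> p \<in> carrier_vec (dim_vec x) \<and>
     (\<forall>\<epsilon>>0. \<exists>\<delta>>0. \<forall>y\<in>S. norm1 (y - x) < \<delta> \<longrightarrow>
        \<bar>\<phi> y - \<phi> x - scalar_prod p (y - x)\<bar> \<le> \<epsilon> * norm1 (y - x))"

text \<open>\<open>df t x\<close> and \<open>dg k x\<close> stand for the gradients of \<open>f t\<close> and \<open>g k\<close> at \<open>x\<close>. The sign conditions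
  on the Lipschitz constants are implied by the Lipschitz bounds unless \<open>d = 1\<close>, where the simplex
  is a single point.\<close>

locale simplex_oco =
  fixes d K :: nat
    and f :: "nat \<Rightarrow> real vec \<Rightarrow> real" and df :: "nat \<Rightarrow> real vec \<Rightarrow> real vec"
    and g :: "nat \<Rightarrow> real vec \<Rightarrow> real" and dg :: "nat \<Rightarrow> real vec \<Rightarrow> real vec"
    and F L\<^sub>f G :: real and Hk :: "nat \<Rightarrow> real" and L\<^sub>g :: real
  assumes d_ge_1: "1 \<le> d" and K_ge_1: "1 \<le> K"
    and L\<^sub>f_nonneg: "0 \<le> L\<^sub>f"
    and L\<^sub>g_nonneg: "0 \<le> L\<^sub>g"
    and Hk_nonneg: "\<And>k. k \<in> {1..K} \<Longrightarrow> 0 \<le> Hk k"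
    and f_convex: "\<And>t. convex_fun_on (simplex d) (f t)"
    and f_grad: "\<And>t x. x \<in> simplex d \<Longrightarrow> has_gradient_on (simplex d) (f t) x (df t x)"
    and g_convex: "\<And>k. k \<in> {1..K} \<Longrightarrow> convex_fun_on (simplex d) (g k)"
    and g_grad: "\<And>k x. k \<in> {1..K} \<Longrightarrow> x \<in> simplex d \<Longrightarrow>
          has_gradient_on (simplex d) (g k) x (dg k x)"
    and f_bound: "\<And>t x. x \<in> simplex d \<Longrightarrow> norm_inf (df t x) \<le> F"
    and f_smooth: "\<And>t x y. x \<in> simplex d \<Longrightarrow> y \<in> simplex d \<Longrightarrow>
          norm_inf (df t x - df t y) \<le> L\<^sub>f * norm1 (x - y)"
    and g_bound: "\<And>x. x \<in> simplex d \<Longrightarrow> (\<Sum>k=1..K. \<bar>g k x\<bar>) \<le> G"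
    and g_lipschitz: "\<And>k x y. k \<in> {1..K} \<Longrightarrow> x \<in> simplex d \<Longrightarrow> y \<in> simplex d \<Longrightarrow>
          \<bar>g k x - g k y\<bar> \<le> Hk k * norm1 (x - y)"
    and g_smooth: "\<And>k x y. k \<in> {1..K} \<Longrightarrow> x \<in> simplex d \<Longrightarrow> y \<in> simplex d \<Longrightarrow>
          norm_inf (dg k x - dg k y) \<le> L\<^sub>g * norm1 (x - y)"

definition slater :: "nat \<Rightarrow> nat \<Rightarrow> (nat \<Rightarrow> real vec \<Rightarrow> real) \<Rightarrow> real \<Rightarrow> bool" where
  "slater d K g \<sigma> \<longleftrightarrow> 0 < \<sigma> \<and> (\<exists>x\<in>simplex d. \<forall>k\<in>{1..K}. g k x \<le> - \<sigma>)"

text \<open>Under the assumptions of \<open>simplex_oco\<close> the supremum is a maximum: the gradients are Lipschitz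
  continuous and the simplex is compact.\<close>

definition V_inf :: "nat \<Rightarrow> (nat \<Rightarrow> real vec \<Rightarrow> real vec) \<Rightarrow> nat \<Rightarrow> real" where
  "V_inf d df T = (\<Sum>t=1..T. SUP x\<in>simplex d. (norm_inf (df t x - df (t - 1) x))\<^sup>2)"

text \<open>The objective shared by the two mirror-prox steps, as a function of \<open>z\<close>: \<open>p\<close> is the loss
  gradient, \<open>q k\<close> the queue length, \<open>w\<close> the previous iterate, \<open>a\<close> the step-size parameter and \<open>y\<close>
  the centre of the divergence.\<close>

definition prox_objective ::
    "nat \<Rightarrow> (nat \<Rightarrow> real vec \<Rightarrow> real) \<Rightarrow> (nat \<Rightarrow> real vec \<Rightarrow> real vec) \<Rightarrow> real \<Rightarrow>
     real vec \<Rightarrow> (nat \<Rightarrow> real) \<Rightarrow> real vec \<Rightarrow> real \<Rightarrow> real vec \<Rightarrow> real vec \<Rightarrow> real" where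
  "prox_objective K g dg \<gamma> p q w a y z =
     scalar_prod p z
     + (\<Sum>k=1..K. (q k + \<gamma> * g k w) * scalar_prod (\<gamma> \<cdot>\<^sub>v dg k w) z)
     + a * KL z y"

text \<open>\<open>x t\<close>, \<open>xt t\<close>, \<open>yt t\<close> and \<open>Q k t\<close> are the iterates of the algorithm; \<open>xt\<close> and \<open>yt\<close> are the
  variables with a tilde, and \<open>xt 0\<close> and \<open>yt 0\<close> are irrelevant.\<close>

locale mirror_prox_run =
  fixes d K :: nat
    and df :: "nat \<Rightarrow> real vec \<Rightarrow> real vec"
    and g :: "nat \<Rightarrow> real vec \<Rightarrow> real" and dg :: "nat \<Rightarrow> real vec \<Rightarrow> real vec"
    and \<gamma> \<nu> :: real and \<alpha> :: "nat \<Rightarrow> real"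
    and x xt yt :: "nat \<Rightarrow> real vec" and Q :: "nat \<Rightarrow> nat \<Rightarrow> real"
  assumes x_init: "x 0 = (1 / real d) \<cdot>\<^sub>v ones d"
    and xt_init: "xt 1 = (1 / real d) \<cdot>\<^sub>v ones d"
    and Q_init: "\<And>k. k \<in> {1..K} \<Longrightarrow> Q k 0 = 0"
    and yt_step: "\<And>t. 1 \<le> t \<Longrightarrow> yt t = (1 - \<nu>) \<cdot>\<^sub>v xt t + (\<nu> / real d) \<cdot>\<^sub>v ones d"
    and Q_step: "\<And>t k. 1 \<le> t \<Longrightarrow> k \<in> {1..K} \<Longrightarrow>
          Q k t = max (- \<gamma> * g k (x (t - 1))) (Q k (t - 1) + \<gamma> * g k (x (t - 1)))"
    and x_step: "\<And>t. 1 \<le> t \<Longrightarrow>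
          is_arg_min (prox_objective K g dg \<gamma> (df (t - 1) (x (t - 1))) (\<lambda>k. Q k t)
                        (x (t - 1)) (\<alpha> t) (yt t))
            (\<lambda>z. z \<in> simplex d) (x t)"
    and xt_step: "\<And>t. 1 \<le> t \<Longrightarrow>
          is_arg_min (prox_objective K g dg \<gamma> (df t (x t)) (\<lambda>k. Q k t)
                        (x (t - 1)) (\<alpha> t) (yt t))
            (\<lambda>z. z \<in> simplex d) (xt (t + 1))"

text \<open>A real polynomial in variables indexed by natural numbers is a finitely supported map from
  exponent vectors to coefficients.\<close>

type_synonym real_mpoly = "(nat \<Rightarrow>\<^sub>0 nat) \<Rightarrow>\<^sub>0 real"

definition nonneg_mpoly :: "nat \<Rightarrow> real_mpoly \<Rightarrow> bool" where
  "nonneg_mpoly n P \<longleftrightarrow>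
     (\<forall>m\<in>Poly_Mapping.keys P. Poly_Mapping.keys m \<subseteq> {..<n} \<and> 0 \<le> Poly_Mapping.lookup P m)"

definition eval_mpoly :: "real_mpoly \<Rightarrow> real list \<Rightarrow> real" where
  "eval_mpoly P vs = (\<Sum>m\<in>Poly_Mapping.keys P.
     Poly_Mapping.lookup P m * (\<Prod>i\<in>Poly_Mapping.keys m. (vs ! i) ^ Poly_Mapping.lookup m i))"

end

theory Submission
  imports Defs "HOL-Analysis.L2_Norm"
begin

text \<open>
  The violation is read off the virtual queues: \<open>Q\<close> grows by at least \<open>\<gamma> g\<close> in every round, so
  \<open>\<gamma> \<Sum> g\<^sub>k(x\<^sub>t) \<le> Q\<^sub>k(T + 1)\<close>, and it suffices to bound the queues by \<open>\<gamma>\<close> times a quantity of order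
  \<open>ln (d T)\<close>. This is a drift argument. Write \<open>E(t) = \<parallel>Q(t)\<parallel>\<^sup>2 / 2\<close>.

  In one round \<open>E\<close> changes by \<open>\<gamma> \<Sum> \<lambda>\<^sub>k g\<^sub>k(x\<^sub>t) + O(\<gamma>\<^sup>2)\<close>, where \<open>\<lambda>\<^sub>k = Q\<^sub>k(t) + \<gamma> g\<^sub>k(x\<^sub>t\<^sub>-\<^sub>1) \<ge> 0\<close> is the
  multiplier that the algorithm uses. The constraints are linearised at \<open>x\<^sub>t\<^sub>-\<^sub>1\<close>, and the optimality of
  the two mirror steps compares the linearisation at \<open>x\<^sub>t\<close> with the one at the Slater point, where
  it is at most \<open>- \<sigma>\<close>. This yields the negative drift \<open>- \<gamma> \<sigma> \<parallel>Q(t)\<parallel>\<^sub>1\<close>. Three errors remain.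
  The loss gradients contribute a constant. The linearisation error is a multiple of
  \<open>\<parallel>x\<^sub>t - x\<^sub>t\<^sub>-\<^sub>1\<parallel>\<^sup>2\<close> with a coefficient proportional to the queues; \<open>\<alpha>\<^sub>t\<close> is large enough for the negative
  squared distances that the mirror steps leave behind (by Pinsker's inequality) to absorb it. The
  divergences to the Slater point appear as \<open>\<alpha>\<^sub>t (\<Phi>\<^sub>t - \<Phi>\<^sub>t\<^sub>+\<^sub>1)\<close> for a potential with
  \<open>0 \<le> \<Phi> \<le> ln (d T) + 2\<close>; mixing in the uniform distribution is what makes \<open>\<Phi>\<close> bounded, and since \<open>\<alpha>\<close>
  is nondecreasing these terms sum over any window of rounds to at most \<open>\<alpha>\<close> at its end times that
  bound. This is \<open>step_drift\<close> and \<open>window_drift\<close>.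

  Now let \<open>M\<close> be the largest value of \<open>\<parallel>Q(t)\<parallel>\<close> up to time \<open>T + 1\<close>, and look at the \<open>n\<close> rounds before it
  is attained. The energy has not decreased over this window, the queues stay above \<open>M - n \<gamma> G\<close> on
  it, and \<open>\<alpha>\<close> is at most \<open>O(\<gamma>\<^sup>2) + 3 \<gamma> L\<^sub>g K M\<close>. So the drift \<open>n \<gamma> \<sigma> M\<close> is bounded by
  \<open>(O(\<gamma>\<^sup>2) + 3 \<gamma> L\<^sub>g K M) (ln (d T) + 9)\<close> plus \<open>\<gamma>\<^sup>2\<close> times a polynomial in \<open>n\<close>. The difficulty is that
  \<open>M\<close> occurs on the right with a logarithmic factor; taking \<open>n\<close> of order \<open>L\<^sub>g K ln (d T) / \<sigma>\<close> makes
  the drift twice as large as this term. What is left is \<open>M = O(\<gamma> ln (d T))\<close>, which is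
  \<open>peak_bound\<close>.
\<close>

section \<open>Relative entropy on the simplex\<close>

text \<open>The factor \<open>(u + 1) ln u - 2 (u - 1)\<close> vanishes at \<open>u = 1\<close> and is nondecreasing, because its
  derivative \<open>ln u + 1 / u - 1\<close> is nonnegative. Up to the factor \<open>4\<close> it is the derivative of the
  difference of the two sides of the next inequality.\<close>

lemma ln_times_succ_sign:
  fixes u :: real
  assumes "0 < u"
  shows "0 \<le> (u - 1) * ((u + 1) * ln u - 2 * (u - 1))"
proof -
  let ?k = "\<lambda>u::real. (u + 1) * ln u - 2 * (u - 1)"
  have der: "\<exists>D. (?k has_real_derivative D) (at v) \<and> 0 \<le> D" if "0 < v" for v :: real
  proof (intro exI conjI)
    show "(?k has_real_derivative (ln v + (v + 1) / v - 2)) (at v)"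
      using that by (auto intro!: derivative_eq_intros)
    have "ln (1 / v) \<le> 1 / v - 1" using that by (intro ln_le_minus_one) simp
    thus "0 \<le> ln v + (v + 1) / v - 2" using that by (simp add: ln_div field_simps)
  qed
  show ?thesis
  proof (cases "1 \<le> u")
    case True
    have "?k 1 \<le> ?k u"
      by (rule DERIV_nonneg_imp_nondecreasing[OF True]) (use der in auto)
    thus ?thesis using True by simp
  next
    case False
    have "?k u \<le> ?k 1"
      by (rule DERIV_nonneg_imp_nondecreasing) (use der False assms in auto)
    thus ?thesis using False by (simp add: mult_nonpos_nonpos)
  qed
qed

text \<open>The pointwise form of Pinsker's inequality: both sides and their derivatives agree at \<open>u = 1\<close>,
  and by the previous lemma the difference decreases before \<open>1\<close> and increases after it.\<close>

lemma entropy_quadratic_minorant: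
  fixes u :: real
  assumes "0 \<le> u"
  shows "3 * (u - 1)\<^sup>2 \<le> (2 * u + 4) * (u * ln u - u + 1)"
proof (cases "u = 0")
  case False
  with assms have u: "0 < u" by simp
  let ?h = "\<lambda>u::real. (2 * u + 4) * (u * ln u - u + 1) - 3 * (u - 1)\<^sup>2"
  let ?h' = "\<lambda>u::real. 4 * ((u + 1) * ln u - 2 * (u - 1))"
  have der: "(?h has_real_derivative ?h' v) (at v)" if "0 < v" for v :: real
    using that by (auto intro!: derivative_eq_intros simp: field_simps)
  have "?h 1 \<le> ?h u"
  proof (cases "1 \<le> u")
    case True
    show ?thesis
    proof (rule DERIV_nonneg_imp_nondecreasing[OF True])
      fix v :: real assume v: "1 \<le> v" "v \<le> u"
      have "0 \<le> ?h' v"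
        using ln_times_succ_sign[of v] v by (cases "v = 1") (auto simp: zero_le_mult_iff)
      thus "\<exists>D. (?h has_real_derivative D) (at v) \<and> 0 \<le> D" using der[of v] v by auto
    qed
  next
    case False
    hence "u \<le> 1" by simp
    thus ?thesis
    proof (rule DERIV_nonpos_imp_nonincreasing)
      fix v :: real assume v: "u \<le> v" "v \<le> 1"
      have "?h' v \<le> 0"
        using ln_times_succ_sign[of v] v u by (cases "v = 1") (auto simp: zero_le_mult_iff)
      thus "\<exists>D. (?h has_real_derivative D) (at v) \<and> D \<le> 0" using der[of v] v u by auto
    qed
  qed
  thus ?thesis by simp
qed simp

text \<open>Cauchy-Schwarz turns the pointwise inequality for \<open>u = a / b\<close> into the global one. The sum of
  the weights \<open>(2 a + 4 b) / 3\<close> is \<open>2\<close>, which gives the constant.\<close>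

lemma pinsker_sum:
  fixes a b :: "'i \<Rightarrow> real"
  assumes a: "\<And>i. i \<in> I \<Longrightarrow> 0 \<le> a i" and b: "\<And>i. i \<in> I \<Longrightarrow> 0 < b i"
    and sa: "sum a I = 1" and sb: "sum b I = 1"
  shows "(\<Sum>i\<in>I. \<bar>a i - b i\<bar>)\<^sup>2 \<le> 2 * (\<Sum>i\<in>I. a i * ln (a i / b i))"
proof -
  define r where "r i = sqrt ((2 * a i + 4 * b i) / 3)" for i
  define s where "s i = sqrt (a i * ln (a i / b i) - a i + b i)" for i
  have pt: "\<bar>a i - b i\<bar> \<le> r i * s i" and sq: "(r i)\<^sup>2 = (2 * a i + 4 * b i) / 3"
    "(s i)\<^sup>2 = a i * ln (a i / b i) - a i + b i" if i: "i \<in> I" for i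
  proof -
    define u where "u = a i / b i"
    have bi: "0 < b i" and u0: "0 \<le> u" and ai: "a i = u * b i"
      using a[OF i] b[OF i] by (auto simp: u_def)
    have key: "3 * (u - 1)\<^sup>2 \<le> (2 * u + 4) * (u * ln u - u + 1)"
      by (rule entropy_quadratic_minorant[OF u0])
    have "0 \<le> u * ln u - u + 1"
      using order_trans[OF _ key, of 0] u0 by (simp add: zero_le_mult_iff)
    moreover have s_eq: "a i * ln (a i / b i) - a i + b i = b i * (u * ln u - u + 1)"
      using bi by (simp add: ai algebra_simps)
    ultimately show s2: "(s i)\<^sup>2 = a i * ln (a i / b i) - a i + b i"
      using bi by (simp add: s_def)
    show r2: "(r i)\<^sup>2 = (2 * a i + 4 * b i) / 3"
      using a[OF i] bi by (simp add: r_def)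
    have "(a i - b i)\<^sup>2 = (b i)\<^sup>2 * (u - 1)\<^sup>2"
      by (simp add: ai power2_eq_square algebra_simps)
    also have "\<dots> \<le> (b i)\<^sup>2 * ((2 * u + 4) * (u * ln u - u + 1) / 3)"
      using key by (intro mult_left_mono) auto
    also have "\<dots> = (r i)\<^sup>2 * (s i)\<^sup>2"
      unfolding r2 s2 s_eq by (simp add: ai power2_eq_square algebra_simps)
    finally have "\<bar>a i - b i\<bar>\<^sup>2 \<le> (r i * s i)\<^sup>2" by (simp add: power_mult_distrib)
    moreover have "0 \<le> r i * s i"
      using \<open>0 \<le> u * ln u - u + 1\<close> a[OF i] bi by (simp add: r_def s_def s_eq)
    ultimately show "\<bar>a i - b i\<bar> \<le> r i * s i" by (rule power2_le_imp_le)
  qed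
  have "(\<Sum>i\<in>I. \<bar>a i - b i\<bar>) \<le> (\<Sum>i\<in>I. \<bar>r i\<bar> * \<bar>s i\<bar>)"
    using pt by (intro sum_mono) (metis abs_ge_self abs_mult order_trans)
  also have "\<dots> \<le> L2_set r I * L2_set s I" by (rule L2_set_mult_ineq)
  finally have "(\<Sum>i\<in>I. \<bar>a i - b i\<bar>)\<^sup>2 \<le> (L2_set r I * L2_set s I)\<^sup>2"
    by (intro power_mono) (auto intro: sum_nonneg)
  also have "\<dots> = (\<Sum>i\<in>I. (r i)\<^sup>2) * (\<Sum>i\<in>I. (s i)\<^sup>2)"
    by (simp add: power_mult_distrib L2_set_def sum_nonneg)
  also have "(\<Sum>i\<in>I. (r i)\<^sup>2) = 2"
    by (simp add: sq sum_divide_distrib[symmetric] sum.distrib sum_distrib_left[symmetric] sa sb)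
  also have "(\<Sum>i\<in>I. (s i)\<^sup>2) = (\<Sum>i\<in>I. a i * ln (a i / b i))"
    by (simp add: sq sum.distrib sum_subtractf sa sb)
  finally show ?thesis .
qed

lemma norm1_carrier: "x \<in> carrier_vec d \<Longrightarrow> norm1 x = (\<Sum>i<d. \<bar>x $ i\<bar>)"
  by (auto simp: norm1_def)

lemma norm1_diff: "x \<in> carrier_vec d \<Longrightarrow> y \<in> carrier_vec d \<Longrightarrow>
    norm1 (x - y) = (\<Sum>i<d. \<bar>x $ i - y $ i\<bar>)"
  by (auto simp: norm1_def)

lemma norm1_nonneg: "0 \<le> norm1 x"
  by (simp add: norm1_def sum_nonneg)

lemma norm1_smult: "norm1 (a \<cdot>\<^sub>v x) = \<bar>a\<bar> * norm1 x"
  by (simp add: norm1_def abs_mult sum_distrib_left)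

lemma norm1_diff_triangle:
  "x \<in> carrier_vec d \<Longrightarrow> y \<in> carrier_vec d \<Longrightarrow> z \<in> carrier_vec d \<Longrightarrow>
    norm1 (x - z) \<le> norm1 (x - y) + norm1 (y - z)"
  by (simp add: norm1_diff sum.distrib[symmetric]) (intro sum_mono, linarith)

lemma simplex_iff:
  "x \<in> simplex d \<longleftrightarrow> x \<in> carrier_vec d \<and> (\<forall>i<d. 0 \<le> x $ i) \<and> (\<Sum>i<d. x $ i) = 1"
  by (auto simp: simplex_def norm1_def)

lemma simplexD:
  assumes "x \<in> simplex d"
  shows "x \<in> carrier_vec d" "dim_vec x = d" "\<And>i. i < d \<Longrightarrow> 0 \<le> x $ i" "(\<Sum>i<d. x $ i) = 1"
  using assms by (auto simp: simplex_iff)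

lemma simplex_coord_le_1: "x \<in> simplex d \<Longrightarrow> i < d \<Longrightarrow> x $ i \<le> 1"
  using member_le_sum[of i "{..<d}" "\<lambda>i. x $ i"] by (auto simp: simplex_iff)

lemma simplex_diameter:
  assumes "x \<in> simplex d" "y \<in> simplex d"
  shows "norm1 (x - y) \<le> 2"
proof -
  have "norm1 (x - y) \<le> (\<Sum>i<d. x $ i + y $ i)"
    unfolding norm1_diff[OF assms[THEN simplexD(1)]]
    by (intro sum_mono) (use assms[THEN simplexD(3)] in force)
  also have "\<dots> = 2" using assms by (simp add: sum.distrib simplexD)
  finally show ?thesis .
qed

lemma scalar_prod_carrier: "x \<in> carrier_vec d \<Longrightarrow> scalar_prod c x = (\<Sum>i<d. c $ i * x $ i)"
  by (auto simp: scalar_prod_def atLeast0LessThan)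

lemma KL_carrier: "x \<in> carrier_vec d \<Longrightarrow> KL x y = (\<Sum>i<d. x $ i * ln (x $ i / y $ i))"
  by (auto simp: KL_def)

lemma pinsker:
  assumes x: "x \<in> simplex d" and y: "y \<in> simplex d" and pos: "\<And>i. i < d \<Longrightarrow> 0 < y $ i"
  shows "(norm1 (x - y))\<^sup>2 / 2 \<le> KL x y"
  using pinsker_sum[of "{..<d}" "\<lambda>i. x $ i" "\<lambda>i. y $ i"] assms
  by (simp add: norm1_diff[of _ d] KL_carrier[of _ d] simplexD)

lemma KL_nonneg:
  assumes "x \<in> simplex d" "y \<in> simplex d" "\<And>i. i < d \<Longrightarrow> 0 < y $ i"
  shows "0 \<le> KL x y"
  by (rule order_trans[OF _ pinsker[OF assms]]) auto

lemma KL_le_ln_inverse_floor: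
  assumes x: "x \<in> simplex d" and m: "0 < m" and y: "\<And>i. i < d \<Longrightarrow> m \<le> y $ i"
  shows "KL x y \<le> ln (1 / m)"
proof -
  have "KL x y \<le> (\<Sum>i<d. x $ i * ln (1 / m))"
    unfolding KL_carrier[OF simplexD(1)[OF x]]
  proof (intro sum_mono)
    fix i assume "i \<in> {..<d}"
    hence i: "i < d" by simp
    have "ln (x $ i / y $ i) \<le> ln (1 / m)" if "0 < x $ i"
      using that m y[OF i] simplex_coord_le_1[OF x i] by (intro ln_mono frac_le) auto
    thus "x $ i * ln (x $ i / y $ i) \<le> x $ i * ln (1 / m)"
      using simplexD(3)[OF x i] by (cases "x $ i = 0") (auto intro: mult_left_mono)
  qed
  also have "\<dots> = ln (1 / m)"
    by (simp add: sum_distrib_right[symmetric] simplexD(4)[OF x])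
  finally show ?thesis .
qed

text \<open>The price of replacing the centre \<open>y\<close> of the divergence by a mixture \<open>w\<close> that keeps at least
  the fraction \<open>c\<close> of \<open>y\<close>.\<close>

lemma KL_second_argument_decrease:
  assumes z: "z \<in> simplex d" and c: "0 < c" and y: "\<And>i. i < d \<Longrightarrow> 0 < y $ i"
    and w: "\<And>i. i < d \<Longrightarrow> c * y $ i \<le> w $ i"
  shows "KL z w \<le> KL z y + ln (1 / c)"
proof -
  have "KL z w \<le> (\<Sum>i<d. z $ i * ln (z $ i / y $ i) + z $ i * ln (1 / c))"
    unfolding KL_carrier[OF simplexD(1)[OF z]]
  proof (intro sum_mono)
    fix i assume "i \<in> {..<d}"
    hence i: "i < d" by simp
    have "ln (z $ i / w $ i) \<le> ln (z $ i / y $ i) + ln (1 / c)" if zi: "0 < z $ i"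
    proof -
      have yi: "0 < c * y $ i" using c y[OF i] by simp
      have "ln (z $ i / w $ i) \<le> ln (z $ i / (c * y $ i))"
        using yi zi w[OF i] by (intro ln_mono divide_left_mono) (auto intro: divide_pos_pos)
      thus ?thesis using zi c y[OF i] by (simp add: ln_div ln_mult)
    qed
    thus "z $ i * ln (z $ i / w $ i) \<le> z $ i * ln (z $ i / y $ i) + z $ i * ln (1 / c)"
      using simplexD(3)[OF z i]
      by (cases "z $ i = 0") (auto simp: distrib_left[symmetric] intro: mult_left_mono)
  qed
  also have "\<dots> = KL z y + ln (1 / c)"
    by (simp add: sum.distrib sum_distrib_right[symmetric] simplexD(4)[OF z]
        KL_carrier[OF simplexD(1)[OF z]])
  finally show ?thesis .
qed

text \<open>The objective \<open>\<langle>c, z\<rangle> + a KL(z, y)\<close> equals \<open>a KL(z, v)\<close> up to an additive constant, where \<open>v\<close>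
  has weights proportional to \<open>y\<^sub>i exp (- c\<^sub>i / a)\<close>. By Pinsker's inequality \<open>v\<close> is the only minimiser,
  so the minimiser is positive and the last conclusion, the three-point property of the mirror
  step, holds with equality. The explicit form replaces first-order optimality conditions.\<close>

lemma entropic_prox:
  assumes d: "1 \<le> d" and a: "0 < a" and y: "\<forall>i<d. 0 < y $ i"
    and min: "is_arg_min (\<lambda>z. scalar_prod c z + a * KL z y) (\<lambda>z. z \<in> simplex d) w"
  shows "w \<in> simplex d" "\<And>i. i < d \<Longrightarrow> 0 < w $ i"
    "\<And>z. z \<in> simplex d \<Longrightarrow>
      scalar_prod c w + a * KL w y + a * KL z w \<le> scalar_prod c z + a * KL z y"
proof -
  have ypos: "0 < y $ i" if "i < d" for i using y that by simp
  define Z where "Z = (\<Sum>i<d. y $ i * exp (- c $ i / a))"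
  define v where "v = vec d (\<lambda>i. y $ i * exp (- c $ i / a) / Z)"
  have Z: "0 < Z" unfolding Z_def using d ypos by (intro sum_pos) (auto simp: lessThan_empty_iff)
  have vpos: "0 < v $ i" if "i < d" for i using that Z ypos[OF that] by (simp add: v_def)
  have "(\<Sum>i<d. v $ i) = (\<Sum>i<d. y $ i * exp (- c $ i / a) / Z)" by (simp add: v_def)
  also have "\<dots> = 1" using Z by (simp only: sum_divide_distrib[symmetric] Z_def[symmetric]) simp
  finally have v: "v \<in> simplex d"
    unfolding simplex_iff using vpos by (auto simp: less_imp_le v_def)
  have split: "scalar_prod c z + a * KL z y = a * KL z v - a * ln Z" if z: "z \<in> simplex d" for z
  proof -
    have "c $ i * z $ i + a * (z $ i * ln (z $ i / y $ i))
        = a * (z $ i * ln (z $ i / v $ i)) - a * ln Z * z $ i" if i: "i < d" for i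
    proof (cases "z $ i = 0")
      case False
      hence zi: "0 < z $ i" using simplexD(3)[OF z i] by simp
      have "ln (v $ i) = ln (y $ i) - c $ i / a - ln Z"
        using i Z ypos[OF i] by (simp add: v_def ln_div ln_mult)
      hence "ln (z $ i / v $ i) = ln (z $ i / y $ i) + c $ i / a + ln Z"
        using zi vpos[OF i] ypos[OF i] by (simp add: ln_div)
      thus ?thesis using a by (simp add: algebra_simps)
    qed simp
    hence "(\<Sum>i<d. c $ i * z $ i + a * (z $ i * ln (z $ i / y $ i)))
        = (\<Sum>i<d. a * (z $ i * ln (z $ i / v $ i)) - a * ln Z * z $ i)" by simp
    thus ?thesis
      by (simp add: scalar_prod_carrier[OF simplexD(1)[OF z]] KL_carrier[OF simplexD(1)[OF z]]
          sum.distrib sum_subtractf sum_distrib_left[symmetric] simplexD(4)[OF z])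
  qed
  have w: "w \<in> simplex d" and le: "\<And>z. z \<in> simplex d \<Longrightarrow>
      scalar_prod c w + a * KL w y \<le> scalar_prod c z + a * KL z y"
    using min by (auto simp: is_arg_min_linorder)
  have KLvv: "KL v v = 0" using vpos by (auto simp: KL_def v_def intro!: sum.neutral)
  have "a * KL w v \<le> 0" using le[OF v] unfolding split[OF w] split[OF v] by (simp add: KLvv)
  hence "KL w v \<le> 0" using a by (simp add: mult_le_0_iff)
  hence "(norm1 (w - v))\<^sup>2 \<le> 0" using pinsker[OF w v vpos] by linarith
  hence "norm1 (w - v) = 0" by simp
  hence "(\<Sum>i<d. \<bar>w $ i - v $ i\<bar>) = 0" by (simp add: norm1_diff[of _ d] simplexD(1)[OF w] simplexD(1)[OF v])
  hence eq: "w = v"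
    using simplexD(1,2)[OF w] simplexD(1,2)[OF v] by (auto simp: sum_nonneg_eq_0_iff intro!: eq_vecI)
  show "w \<in> simplex d" by (rule w)
  show "\<And>i. i < d \<Longrightarrow> 0 < w $ i" using vpos eq by simp
  show "scalar_prod c w + a * KL w y + a * KL z w \<le> scalar_prod c z + a * KL z y"
    if "z \<in> simplex d" for z
    unfolding split[OF that] split[OF w] by (simp add: eq KLvv)
qed

section \<open>Convex functions with Lipschitz gradient\<close>

lemma simplex_convex_comb:
  assumes x: "x \<in> simplex d" and y: "y \<in> simplex d" and u: "0 \<le> u" "u \<le> 1"
  shows "(1 - u) \<cdot>\<^sub>v x + u \<cdot>\<^sub>v y \<in> simplex d"
  unfolding simplex_iff using simplexD[OF x] simplexD[OF y] u
  by (auto simp: sum.distrib sum_distrib_left[symmetric])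

text \<open>The derivative of a convex function along a chord is at most the slope of the chord. The
  derivative is taken relative to the simplex, so it is evaluated at points of the chord only.\<close>

lemma gradient_inequality:
  assumes conv: "convex_fun_on (simplex d) \<phi>" and grad: "has_gradient_on (simplex d) \<phi> x p"
    and x: "x \<in> simplex d" and y: "y \<in> simplex d"
  shows "\<phi> x + scalar_prod p (y - x) \<le> \<phi> y"
proof (rule field_le_epsilon)
  fix e :: real assume e: "0 < e"
  define N where "N = norm1 (y - x)"
  have N: "0 \<le> N" by (simp add: N_def norm1_nonneg)
  have dims: "p \<in> carrier_vec d" "y - x \<in> carrier_vec d"
    using grad simplexD(1,2)[OF x] simplexD(1)[OF y] by (auto simp: has_gradient_on_def)
  obtain \<delta> where \<delta>: "0 < \<delta>" and near: "\<And>z. z \<in> simplex d \<Longrightarrow> norm1 (z - x) < \<delta> \<Longrightarrow>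
      \<bar>\<phi> z - \<phi> x - scalar_prod p (z - x)\<bar> \<le> e / (N + 1) * norm1 (z - x)"
  proof -
    have "0 < e / (N + 1)" using e N by simp
    thus ?thesis using grad that unfolding has_gradient_on_def by meson
  qed
  define u where "u = min 1 (\<delta> / (2 * (N + 1)))"
  have u: "0 < u" "u \<le> 1" using \<delta> N by (auto simp: u_def)
  define z where "z = (1 - u) \<cdot>\<^sub>v x + u \<cdot>\<^sub>v y"
  have z: "z \<in> simplex d" unfolding z_def by (rule simplex_convex_comb[OF x y]) (use u in auto)
  have zx: "z - x = u \<cdot>\<^sub>v (y - x)"
    using simplexD(1,2)[OF x] simplexD(1,2)[OF y] by (auto simp: z_def algebra_simps intro!: eq_vecI)
  have nz: "norm1 (z - x) = u * N"
    using u by (simp add: zx N_def norm1_smult)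
  have "u * N \<le> \<delta> / (2 * (N + 1)) * N" using N by (intro mult_right_mono) (auto simp: u_def)
  also have "\<dots> < \<delta>" using \<delta> N by (simp add: divide_simps)
  finally have "\<bar>\<phi> z - \<phi> x - u * scalar_prod p (y - x)\<bar> \<le> e / (N + 1) * (u * N)"
    using near[OF z] nz scalar_prod_smult_distrib[of p d "y - x" u] dims by (simp add: zx)
  moreover have "\<phi> z \<le> (1 - u) * \<phi> x + u * \<phi> y"
    using conv x y u unfolding convex_fun_on_def z_def by simp
  ultimately have "u * scalar_prod p (y - x) \<le> u * (\<phi> y - \<phi> x) + u * (e / (N + 1) * N)"
    by (simp add: algebra_simps abs_le_iff)
  hence "u * scalar_prod p (y - x) \<le> u * (\<phi> y - \<phi> x + e / (N + 1) * N)" 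
    by (simp only: distrib_left)
  hence "scalar_prod p (y - x) \<le> \<phi> y - \<phi> x + e / (N + 1) * N" using u by simp
  also have "e / (N + 1) * N \<le> e" using e N by (simp add: field_simps)
  finally show "\<phi> x + scalar_prod p (y - x) \<le> \<phi> y + e" by simp
qed

lemma norm_inf_coord: "i < dim_vec c \<Longrightarrow> \<bar>c $ i\<bar> \<le> norm_inf c"
  by (auto simp: norm_inf_def)

lemma scalar_prod_le_norms:
  assumes c: "norm_inf c \<le> b" and dims: "dim_vec c = d" "z \<in> carrier_vec d"
  shows "\<bar>scalar_prod c z\<bar> \<le> b * norm1 z"
proof -
  have "\<bar>scalar_prod c z\<bar> \<le> (\<Sum>i<d. \<bar>c $ i\<bar> * \<bar>z $ i\<bar>)"
    unfolding scalar_prod_carrier[OF dims(2)] abs_mult[symmetric] by (rule sum_abs)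
  also have "\<dots> \<le> (\<Sum>i<d. b * \<bar>z $ i\<bar>)"
    using dims norm_inf_coord[of _ c] c by (intro sum_mono mult_right_mono) (force intro: order_trans)+
  also have "\<dots> = b * norm1 z" by (simp add: norm1_carrier[OF dims(2)] sum_distrib_left)
  finally show ?thesis .
qed

text \<open>The gradient inequality at \<open>y\<close> alone gives the quadratic term with constant \<open>L\<close>. Using it on
  each half of the segment, at \<open>y\<close> and at the midpoint, improves the constant to \<open>3 L / 4\<close>. The drift
  estimate has room for exactly this constant, and no integral along the segment is involved.\<close>

lemma smooth_convex_upper_bound:
  assumes conv: "convex_fun_on (simplex d) \<phi>"
    and grad: "\<And>x. x \<in> simplex d \<Longrightarrow> has_gradient_on (simplex d) \<phi> x (D x)"
    and smooth: "\<And>x y. x \<in> simplex d \<Longrightarrow> y \<in> simplex d \<Longrightarrow>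
      norm_inf (D x - D y) \<le> L * norm1 (x - y)"
    and x: "x \<in> simplex d" and y: "y \<in> simplex d"
  shows "\<phi> y \<le> \<phi> x + scalar_prod (D x) (y - x) + 3 / 4 * L * (norm1 (y - x))\<^sup>2"
proof -
  define m where "m = (1 - 1 / 2) \<cdot>\<^sub>v x + (1 / 2) \<cdot>\<^sub>v y"
  have m: "m \<in> simplex d" unfolding m_def by (rule simplex_convex_comb[OF x y]) auto
  note cx = simplexD(1,2)[OF x] and cy = simplexD(1,2)[OF y] and cm = simplexD(1,2)[OF m]
  have dimD: "D z \<in> carrier_vec d" "dim_vec (D z) = d" if "z \<in> simplex d" for z
    using grad[OF that] simplexD(2)[OF that] by (auto simp: has_gradient_on_def)
  let ?N = "norm1 (y - x)"
  define h where "h = (1 / 2) \<cdot>\<^sub>v (y - x)"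
  have half: "y - m = h" "m - x = h" "m - y = - h" "x - m = - h"
    using cx cy by (auto simp: m_def h_def field_simps intro!: eq_vecI)
  have h: "h \<in> carrier_vec d" "dim_vec h = d" using cx cy by (auto simp: h_def)
  have nh: "norm1 h = ?N / 2"
    by (simp add: h_def norm1_smult)
  have seg: "scalar_prod (D z) h \<le> scalar_prod (D x) h + L * norm1 (z - x) * (?N / 2)"
    if z: "z \<in> simplex d" for z
  proof -
    have "scalar_prod (D z - D x) h \<le> L * norm1 (z - x) * norm1 h"
      using scalar_prod_le_norms[OF smooth[OF z x], of d h] h dimD[OF z] dimD[OF x] by simp
    thus ?thesis using minus_scalar_prod_distrib[OF dimD(1)[OF z] dimD(1)[OF x] h(1)] nh by simp
  qed
  have "\<phi> y - \<phi> m \<le> scalar_prod (D y) h"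
    using gradient_inequality[OF conv grad[OF y] y m] h dimD[OF y] half by simp
  moreover have "\<phi> m - \<phi> x \<le> scalar_prod (D m) h"
    using gradient_inequality[OF conv grad[OF m] m x] h dimD[OF m] half by simp
  moreover have "scalar_prod (D x) h = scalar_prod (D x) (y - x) / 2"
    using cx cy dimD[OF x] by (simp add: h_def scalar_prod_smult_distrib[of _ d])
  ultimately have "\<phi> y - \<phi> x \<le> scalar_prod (D x) (y - x) + L * ?N * (?N / 2) + L * (?N / 2) * (?N / 2)"
    using seg[OF y] seg[OF m] half nh by simp
  thus ?thesis by (simp add: power2_eq_square)
qed

section \<open>Virtual queues\<close>

text \<open>A run of the algorithm with a fixed Slater point \<open>xs\<close>. The gradient variation enters the analysis
  through \<open>1 \<le> \<gamma>\<close> and \<open>\<eta> = 1 / \<gamma>\<^sup>2\<close>.\<close>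

locale primal_dual_run =
  simplex_oco d K f df g dg F L\<^sub>f G Hk L\<^sub>g + mirror_prox_run d K df g dg \<gamma> \<nu> \<alpha> x xt yt Q
  for d K f df g dg F L\<^sub>f G Hk L\<^sub>g \<gamma> \<nu> \<alpha> x xt yt Q +
  fixes T :: nat and H \<eta> \<sigma> :: real and \<xi> :: "nat \<Rightarrow> real" and xs :: "real vec"
  assumes T: "2 < T"
    and H: "H = (\<Sum>k=1..K. Hk k)"
    and \<gamma>: "1 \<le> \<gamma>"
    and \<eta>: "\<eta> = 1 / \<gamma>\<^sup>2"
    and \<nu>: "\<nu> = 1 / real T"
    and \<xi>: "\<And>t. 1 \<le> t \<Longrightarrow> \<xi> t = \<gamma> * L\<^sub>g * (\<Sum>k=1..K. \<bar>Q k t\<bar>) + \<gamma>\<^sup>2 * (L\<^sub>g * G + H\<^sup>2)"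
    and \<alpha>_0: "\<alpha> 0 = 0"
    and \<alpha>_step: "\<And>t. 1 \<le> t \<Longrightarrow>
      \<alpha> t = max (3 * (\<eta> * L\<^sub>f\<^sup>2 + \<gamma>\<^sup>2 * L\<^sub>g * G) + 2 / \<eta> + 3 * \<xi> t) (\<alpha> (t - 1))"
    and \<sigma>: "0 < \<sigma>"
    and xs: "xs \<in> simplex d"
    and slater_point: "\<And>k. k \<in> {1..K} \<Longrightarrow> g k xs \<le> - \<sigma>"
begin

abbreviation total_queue :: "nat \<Rightarrow> real" where
  "total_queue t \<equiv> (\<Sum>k=1..K. Q k t)"

abbreviation energy :: "nat \<Rightarrow> real" where
  "energy t \<equiv> (\<Sum>k=1..K. (Q k t)\<^sup>2) / 2"

definition multiplier :: "nat \<Rightarrow> nat \<Rightarrow> real" where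
  "multiplier k t = Q k t + \<gamma> * g k (x (t - 1))"

lemma queue_Suc:
  "k \<in> {1..K} \<Longrightarrow> Q k (Suc t) = max (- \<gamma> * g k (x t)) (Q k t + \<gamma> * g k (x t))"
  using Q_step[of "Suc t" k] by simp

lemma G_nonneg: "0 \<le> G"
  by (rule order_trans[OF _ g_bound[OF xs]]) (simp add: sum_nonneg)

lemma uniform_point: "(1 / real d) \<cdot>\<^sub>v ones d \<in> simplex d"
  using d_ge_1 by (auto simp: simplex_iff ones_def)

lemma x_simplex: "x t \<in> simplex d"
proof (cases t)
  case 0
  thus ?thesis using uniform_point by (simp add: x_init)
next
  case (Suc n)
  thus ?thesis using x_step[of t] by (simp add: is_arg_min_linorder)
qed

lemma queue_nonneg: "k \<in> {1..K} \<Longrightarrow> 0 \<le> Q k t"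
proof (induction t)
  case (Suc t)
  have "0 \<le> Q k t" by (rule Suc.IH[OF Suc.prems])
  thus ?case using queue_Suc[OF Suc.prems, of t] \<gamma>
    by (cases "g k (x t) \<le> 0") (auto simp: max_def mult_le_0_iff zero_le_mult_iff not_le)
qed (simp add: Q_init)

lemma multiplier_nonneg: "1 \<le> t \<Longrightarrow> k \<in> {1..K} \<Longrightarrow> 0 \<le> multiplier k t"
  using Q_step[of t k] by (simp add: multiplier_def)

lemma queue_change:
  assumes k: "k \<in> {1..K}"
  shows "\<bar>Q k (Suc t) - Q k t\<bar> \<le> \<gamma> * \<bar>g k (x t)\<bar>"
proof -
  have "\<gamma> * \<bar>g k (x t)\<bar> = \<bar>\<gamma> * g k (x t)\<bar>" using \<gamma> by (simp add: abs_mult)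
  thus ?thesis using queue_Suc[OF k, of t] queue_nonneg[OF k, of t]
    by (auto simp: max_def abs_if)
qed

lemma total_queue_change: "\<bar>total_queue (Suc t) - total_queue t\<bar> \<le> \<gamma> * G"
proof -
  have "\<bar>total_queue (Suc t) - total_queue t\<bar> \<le> (\<Sum>k=1..K. \<bar>Q k (Suc t) - Q k t\<bar>)"
    by (simp add: sum_subtractf[symmetric] sum_abs)
  also have "\<dots> \<le> (\<Sum>k=1..K. \<gamma> * \<bar>g k (x t)\<bar>)" by (intro sum_mono queue_change)
  also have "\<dots> \<le> \<gamma> * G"
    using g_bound[OF x_simplex, of t] \<gamma> by (simp add: sum_distrib_left[symmetric])
  finally show ?thesis .
qed

lemma total_queue_lipschitz: "\<bar>total_queue (s + n) - total_queue s\<bar> \<le> real n * (\<gamma> * G)"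
proof (induction n)
  case (Suc n)
  thus ?case using total_queue_change[of "s + n"] by (simp add: algebra_simps)
qed simp

lemma sum_g_squares: "(\<Sum>k=1..K. (g k (x t))\<^sup>2) \<le> G\<^sup>2"
  and sum_g_products: "(\<Sum>k=1..K. \<bar>g k (x s)\<bar> * \<bar>g k (x t)\<bar>) \<le> G\<^sup>2"
proof -
  show *: "(\<Sum>k=1..K. \<bar>g k (x s)\<bar> * \<bar>g k (x t)\<bar>) \<le> G\<^sup>2" for s t
  proof -
    have "(\<Sum>k=1..K. \<bar>g k (x s)\<bar> * \<bar>g k (x t)\<bar>) \<le> (\<Sum>k=1..K. \<bar>g k (x s)\<bar> * G)"
    proof (intro sum_mono mult_left_mono)
      fix k assume k: "k \<in> {1..K}"
      show "\<bar>g k (x t)\<bar> \<le> G"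
        by (rule order_trans[OF member_le_sum[OF k] g_bound[OF x_simplex]]) auto
    qed auto
    also have "\<dots> \<le> G * G"
      using g_bound[OF x_simplex, of s] G_nonneg
      by (simp add: sum_distrib_right[symmetric] mult_right_mono)
    finally show ?thesis by (simp add: power2_eq_square)
  qed
  show "(\<Sum>k=1..K. (g k (x t))\<^sup>2) \<le> G\<^sup>2"
    using *[of t t] by (simp add: power2_eq_square)
qed

text \<open>If the first entry of the maximum is active, the new queue length is \<open>- \<gamma> g\<close>; in both cases its
  square is at most \<open>(Q + \<gamma> g)\<^sup>2 + (\<gamma> g)\<^sup>2\<close>. Passing from \<open>Q\<close> to the multiplier costs a product of two
  values of \<open>\<gamma> g\<close>.\<close>

lemma energy_drift:
  "energy (Suc t) - energy t \<le> \<gamma> * (\<Sum>k=1..K. multiplier k t * g k (x t)) + 2 * \<gamma>\<^sup>2 * G\<^sup>2"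
proof -
  have "(Q k (Suc t))\<^sup>2 / 2 - (Q k t)\<^sup>2 / 2
      \<le> \<gamma> * (multiplier k t * g k (x t))
        + \<gamma>\<^sup>2 * (\<bar>g k (x (t - 1))\<bar> * \<bar>g k (x t)\<bar>) + \<gamma>\<^sup>2 * (g k (x t))\<^sup>2"
    if k: "k \<in> {1..K}" for k
  proof -
    define a where "a = \<gamma> * g k (x t)"
    define b where "b = \<gamma> * g k (x (t - 1))"
    have Q: "Q k (Suc t) = max (- a) (Q k t + a)" using queue_Suc[OF k, of t] by (simp add: a_def)
    have "(Q k (Suc t))\<^sup>2 \<le> (Q k t + a)\<^sup>2 + a\<^sup>2" unfolding Q max_def by auto
    hence "(Q k (Suc t))\<^sup>2 / 2 - (Q k t)\<^sup>2 / 2 \<le> Q k t * a + a\<^sup>2"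
      by (simp add: power2_eq_square algebra_simps)
    moreover have "- (b * a) \<le> \<bar>b\<bar> * \<bar>a\<bar>" by (metis abs_ge_minus_self abs_mult)
    moreover have "Q k t * a = \<gamma> * (multiplier k t * g k (x t)) - b * a"
      by (simp add: multiplier_def a_def b_def algebra_simps)
    moreover have "\<bar>b\<bar> * \<bar>a\<bar> = \<gamma>\<^sup>2 * (\<bar>g k (x (t - 1))\<bar> * \<bar>g k (x t)\<bar>)" "a\<^sup>2 = \<gamma>\<^sup>2 * (g k (x t))\<^sup>2"
      using \<gamma> by (simp_all add: a_def b_def abs_mult power2_eq_square)
    ultimately show ?thesis by linarith
  qed
  hence "(\<Sum>k=1..K. (Q k (Suc t))\<^sup>2 / 2 - (Q k t)\<^sup>2 / 2)
      \<le> (\<Sum>k=1..K. \<gamma> * (multiplier k t * g k (x t))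
        + \<gamma>\<^sup>2 * (\<bar>g k (x (t - 1))\<bar> * \<bar>g k (x t)\<bar>) + \<gamma>\<^sup>2 * (g k (x t))\<^sup>2)"
    by (rule sum_mono)
  also have "\<dots> = \<gamma> * (\<Sum>k=1..K. multiplier k t * g k (x t))
      + \<gamma>\<^sup>2 * (\<Sum>k=1..K. \<bar>g k (x (t - 1))\<bar> * \<bar>g k (x t)\<bar>) + \<gamma>\<^sup>2 * (\<Sum>k=1..K. (g k (x t))\<^sup>2)"
    by (simp add: sum.distrib sum_distrib_left)
  also have "\<dots> \<le> \<gamma> * (\<Sum>k=1..K. multiplier k t * g k (x t)) + \<gamma>\<^sup>2 * G\<^sup>2 + \<gamma>\<^sup>2 * G\<^sup>2"
    using \<gamma> by (intro add_mono mult_left_mono sum_g_squares sum_g_products order_refl) auto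
  finally show ?thesis by (simp add: sum_subtractf sum_divide_distrib[symmetric] algebra_simps)
qed

lemma violation_le_queue:
  assumes k: "k \<in> {1..K}"
  shows "\<gamma> * (\<Sum>t=1..n. g k (x t)) \<le> Q k (Suc n)"
proof (induction n)
  case 0
  thus ?case using queue_nonneg[OF k, of 1] by simp
next
  case (Suc n)
  thus ?case using queue_Suc[OF k, of "Suc n"] by (simp add: distrib_left)
qed

section \<open>Step sizes\<close>

lemma \<eta>_bounds: "0 < \<eta>" "\<eta> \<le> \<gamma>\<^sup>2" "2 / \<eta> = 2 * \<gamma>\<^sup>2"
proof -
  have g1: "1 \<le> \<gamma>\<^sup>2" using \<gamma> by (simp add: one_le_power)
  hence "1 / \<gamma>\<^sup>2 \<le> 1" by (simp add: divide_le_eq)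
  thus "\<eta> \<le> \<gamma>\<^sup>2" unfolding \<eta> using g1 by (rule order_trans)
  show "0 < \<eta>" "2 / \<eta> = 2 * \<gamma>\<^sup>2" using \<gamma> by (simp_all add: \<eta>)
qed

lemma \<xi>_queue: "1 \<le> t \<Longrightarrow> \<xi> t = \<gamma> * L\<^sub>g * total_queue t + \<gamma>\<^sup>2 * (L\<^sub>g * G + H\<^sup>2)"
  using \<xi>[of t] queue_nonneg by simp

lemma total_queue_nonneg: "0 \<le> total_queue t"
  by (intro sum_nonneg queue_nonneg)

lemma \<alpha>_mono: "1 \<le> t \<Longrightarrow> \<alpha> t \<le> \<alpha> (Suc t)"
  using \<alpha>_step[of "Suc t"] by simp

text \<open>The second bound is what the absorption of the linearisation error needs: up to the factor
  \<open>\<gamma> L\<^sub>g\<close>, its left-hand side is three times an upper bound for the sum of the multipliers.\<close>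

lemma \<alpha>_lower:
  assumes t: "1 \<le> t"
  shows "0 < \<alpha> t" "3 * (\<gamma> * L\<^sub>g * (total_queue t + \<gamma> * G)) \<le> \<alpha> t"
proof -
  have nn: "0 \<le> \<eta> * L\<^sub>f\<^sup>2" "0 \<le> \<gamma>\<^sup>2 * L\<^sub>g * G" "0 < 2 / \<eta>" "0 \<le> \<gamma>\<^sup>2 * H\<^sup>2"
    "0 \<le> \<gamma> * L\<^sub>g * total_queue t"
    using \<eta>_bounds \<gamma> L\<^sub>g_nonneg G_nonneg total_queue_nonneg[of t] by auto
  have "3 * (\<eta> * L\<^sub>f\<^sup>2 + \<gamma>\<^sup>2 * L\<^sub>g * G) + 2 / \<eta> + 3 * \<xi> t \<le> \<alpha> t"
    using \<alpha>_step[OF t] by simp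
  hence le: "2 / \<eta> + 3 * \<xi> t \<le> \<alpha> t" using nn by argo
  have eq: "\<xi> t = \<gamma> * L\<^sub>g * (total_queue t + \<gamma> * G) + \<gamma>\<^sup>2 * H\<^sup>2"
    by (simp add: \<xi>_queue[OF t] power2_eq_square algebra_simps)
  have "0 \<le> \<gamma> * L\<^sub>g * (total_queue t + \<gamma> * G)"
    using \<gamma> L\<^sub>g_nonneg G_nonneg total_queue_nonneg[of t] by simp
  thus "3 * (\<gamma> * L\<^sub>g * (total_queue t + \<gamma> * G)) \<le> \<alpha> t" "0 < \<alpha> t"
    using le nn unfolding eq by argo+
qed

lemma \<alpha>_upper:
  assumes "1 \<le> t" and "\<And>s. 1 \<le> s \<Longrightarrow> s \<le> t \<Longrightarrow> total_queue s \<le> m"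
  shows "\<alpha> t \<le> (3 * L\<^sub>f\<^sup>2 + 6 * L\<^sub>g * G + 3 * H\<^sup>2 + 2) * \<gamma>\<^sup>2 + 3 * \<gamma> * L\<^sub>g * m" (is "_ \<le> ?b")
  using assms
proof (induction t)
  case (Suc t)
  have m: "0 \<le> m" using Suc.prems(2)[of 1] total_queue_nonneg[of 1] by linarith
  have "\<eta> * L\<^sub>f\<^sup>2 \<le> \<gamma>\<^sup>2 * L\<^sub>f\<^sup>2" using \<eta>_bounds by (intro mult_right_mono) auto
  moreover have "\<gamma> * L\<^sub>g * total_queue (Suc t) \<le> \<gamma> * L\<^sub>g * m"
    using Suc.prems \<gamma> L\<^sub>g_nonneg by (intro mult_left_mono) auto
  ultimately have "3 * (\<eta> * L\<^sub>f\<^sup>2 + \<gamma>\<^sup>2 * L\<^sub>g * G) + 2 / \<eta> + 3 * \<xi> (Suc t) \<le> ?b"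
    unfolding \<xi>_queue[OF Suc.prems(1)] \<eta>_bounds(3) by (simp add: algebra_simps)
  moreover have "\<alpha> t \<le> ?b"
  proof (cases "t = 0")
    case True
    thus ?thesis using \<alpha>_0 m L\<^sub>g_nonneg G_nonneg \<gamma> by simp
  next
    case False
    thus ?thesis using Suc.IH Suc.prems(2) by simp
  qed
  ultimately show ?case using \<alpha>_step[OF Suc.prems(1)] by simp
qed simp

section \<open>Mirror steps\<close>

text \<open>The linear term that the constraints contribute to the objective of both mirror steps of
  round \<open>t\<close>.\<close>

definition penalty :: "nat \<Rightarrow> real vec \<Rightarrow> real" where
  "penalty t z = (\<Sum>k=1..K. multiplier k t * scalar_prod (\<gamma> \<cdot>\<^sub>v dg k (x (t - 1))) z)"

lemma dg_carrier: "k \<in> {1..K} \<Longrightarrow> w \<in> simplex d \<Longrightarrow> dg k w \<in> carrier_vec d"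
  using g_grad[of k w] simplexD(2)[of w d] by (simp add: has_gradient_on_def)

lemma df_carrier: "w \<in> simplex d \<Longrightarrow> df t w \<in> carrier_vec d"
  using f_grad[of w t] simplexD(2)[of w d] by (simp add: has_gradient_on_def)

text \<open>The three-point property for a mirror step of round \<open>t\<close>, for both loss gradients \<open>p\<close> at once.\<close>

lemma prox_step:
  assumes t: "1 \<le> t" and ypos: "\<forall>i<d. 0 < yt t $ i"
    and min: "is_arg_min (prox_objective K g dg \<gamma> p (\<lambda>k. Q k t) (x (t - 1)) (\<alpha> t) (yt t))
            (\<lambda>z. z \<in> simplex d) w"
  shows "w \<in> simplex d" "\<And>i. i < d \<Longrightarrow> 0 < w $ i"
    "\<And>z. z \<in> simplex d \<Longrightarrow>
      scalar_prod p w + penalty t w + \<alpha> t * KL w (yt t) + \<alpha> t * KL z w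
        \<le> scalar_prod p z + penalty t z + \<alpha> t * KL z (yt t)"
proof -
  define c where
    "c = vec d (\<lambda>i. p $ i + (\<Sum>k=1..K. multiplier k t * (\<gamma> \<cdot>\<^sub>v dg k (x (t - 1))) $ i))"
  have c: "scalar_prod c z = scalar_prod p z + penalty t z" if "z \<in> simplex d" for z
  proof -
    have "penalty t z
        = (\<Sum>k=1..K. \<Sum>i<d. multiplier k t * (\<gamma> \<cdot>\<^sub>v dg k (x (t - 1))) $ i * z $ i)"
      by (simp only: penalty_def scalar_prod_carrier[OF simplexD(1)[OF that]] sum_distrib_left mult.assoc)
    also have "\<dots> = (\<Sum>i<d. \<Sum>k=1..K. multiplier k t * (\<gamma> \<cdot>\<^sub>v dg k (x (t - 1))) $ i * z $ i)"
      by (rule sum.swap)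
    finally show ?thesis
      unfolding scalar_prod_carrier[OF simplexD(1)[OF that]]
      by (simp add: c_def distrib_right sum.distrib sum_distrib_right del: index_smult_vec)
  qed
  have obj: "prox_objective K g dg \<gamma> p (\<lambda>k. Q k t) (x (t - 1)) (\<alpha> t) (yt t) z
      = scalar_prod c z + \<alpha> t * KL z (yt t)" if "z \<in> simplex d" for z
    by (simp add: c[OF that] prox_objective_def penalty_def multiplier_def)
  have "is_arg_min (\<lambda>z. scalar_prod c z + \<alpha> t * KL z (yt t)) (\<lambda>z. z \<in> simplex d) w"
    using min obj by (auto simp: is_arg_min_linorder)
  note prox = entropic_prox[OF d_ge_1 \<alpha>_lower(1)[OF t] ypos this]
  show "w \<in> simplex d" "\<And>i. i < d \<Longrightarrow> 0 < w $ i" using prox by auto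
  show "scalar_prod p w + penalty t w + \<alpha> t * KL w (yt t) + \<alpha> t * KL z w
      \<le> scalar_prod p z + penalty t z + \<alpha> t * KL z (yt t)" if "z \<in> simplex d" for z
    using prox(3)[OF that] c[OF that] c[OF prox(1)] by simp
qed

lemma \<nu>_bounds: "0 < \<nu>" "\<nu> \<le> 1 / 2"
  using T by (auto simp: \<nu> field_simps)

lemma xt_simplex: "1 \<le> t \<Longrightarrow> xt t \<in> simplex d"
proof (cases "t = 1")
  case True
  thus ?thesis using uniform_point xt_init by simp
next
  case False
  assume "1 \<le> t"
  thus ?thesis using False xt_step[of "t - 1"] by (simp add: is_arg_min_linorder)
qed

lemma yt_coord: "1 \<le> t \<Longrightarrow> i < d \<Longrightarrow> yt t $ i = (1 - \<nu>) * xt t $ i + \<nu> / real d"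
  using yt_step[of t] simplexD(1,2)[OF xt_simplex[of t]] by (simp add: ones_def)

lemma yt_simplex:
  assumes t: "1 \<le> t"
  shows "yt t \<in> simplex d"
proof -
  have "yt t = (1 - \<nu>) \<cdot>\<^sub>v xt t + \<nu> \<cdot>\<^sub>v ((1 / real d) \<cdot>\<^sub>v ones d)"
    using yt_step[OF t] by (auto simp: smult_smult_assoc ones_def)
  thus ?thesis
    using simplex_convex_comb[OF xt_simplex[OF t] uniform_point, of \<nu>] \<nu>_bounds by simp
qed

lemma yt_floor:
  assumes t: "1 \<le> t" and i: "i < d"
  shows "\<nu> / real d \<le> yt t $ i" "(1 - \<nu>) * xt t $ i \<le> yt t $ i" "0 < yt t $ i"
proof -
  have "0 \<le> (1 - \<nu>) * xt t $ i" "0 < \<nu> / real d"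
    using \<nu>_bounds simplexD(3)[OF xt_simplex[OF t] i] d_ge_1 by auto
  thus "\<nu> / real d \<le> yt t $ i" "(1 - \<nu>) * xt t $ i \<le> yt t $ i" "0 < yt t $ i"
    using yt_coord[OF t i] by auto
qed

lemma yt_near_xt:
  assumes t: "1 \<le> t"
  shows "norm1 (yt t - xt t) \<le> 2 * \<nu>"
proof -
  let ?u = "(1 / real d) \<cdot>\<^sub>v ones d"
  have "yt t - xt t = \<nu> \<cdot>\<^sub>v (?u - xt t)"
    using simplexD(1,2)[OF xt_simplex[OF t]] simplexD(1,2)[OF yt_simplex[OF t]] yt_coord[OF t]
    by (auto simp: ones_def algebra_simps intro!: eq_vecI)
  hence "norm1 (yt t - xt t) = \<nu> * norm1 (?u - xt t)" using \<nu>_bounds by (simp add: norm1_smult)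
  also have "\<dots> \<le> \<nu> * 2"
    using \<nu>_bounds simplex_diameter[OF uniform_point xt_simplex[OF t]] by (intro mult_left_mono) auto
  finally show ?thesis by simp
qed

lemma F_nonneg: "0 \<le> F"
proof -
  have "\<bar>df 0 xs $ 0\<bar> \<le> F"
    using norm_inf_coord[of 0 "df 0 xs"] f_bound[OF xs, of 0] df_carrier[OF xs, of 0] d_ge_1 by simp
  thus ?thesis by simp
qed

lemma loss_term_bound:
  assumes w: "w \<in> simplex d" and u: "u \<in> simplex d" and v: "v \<in> simplex d"
  shows "scalar_prod (df t w) u - scalar_prod (df t w) v \<le> 2 * F"
proof -
  note cu = simplexD(1)[OF u] and cv = simplexD(1)[OF v]
  have "scalar_prod (df t w) u - scalar_prod (df t w) v = scalar_prod (df t w) (u - v)"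
    by (rule scalar_prod_minus_distrib[OF df_carrier[OF w] cu cv, symmetric])
  also have "\<dots> \<le> F * norm1 (u - v)"
    using scalar_prod_le_norms[OF f_bound[OF w, of t], of d "u - v"] df_carrier[OF w, of t] cu cv
    by simp
  also have "\<dots> \<le> F * 2" using simplex_diameter[OF u v] F_nonneg by (rule mult_left_mono)
  finally show ?thesis by simp
qed

text \<open>The sum of two three-point inequalities: the step to \<open>xt (Suc t)\<close> compared with \<open>z\<close>, and the
  step to \<open>x t\<close> compared with \<open>xt (Suc t)\<close>. The divergence of \<open>xt (Suc t)\<close> from \<open>yt t\<close> cancels; the other
  two divergences are bounded below by Pinsker's inequality. Each of the two loss
  gradients costs at most \<open>2 F\<close>, which is affordable because an error of order \<open>\<gamma>\<^sup>2\<close> per round only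
  shifts the queues by \<open>O(\<gamma>)\<close>.\<close>

lemma mirror_prox_gap:
  assumes t: "1 \<le> t" and z: "z \<in> simplex d"
  shows "penalty t (x t) - penalty t z \<le> 4 * F + \<alpha> t * (KL z (yt t) - KL z (xt (Suc t))
      - (norm1 (xt (Suc t) - x t))\<^sup>2 / 2 - (norm1 (x t - yt t))\<^sup>2 / 2)"
proof -
  have ypos: "\<forall>i<d. 0 < yt t $ i" using yt_floor(3)[OF t] by simp
  note px = prox_step[OF t ypos x_step[OF t]]
  have "is_arg_min (prox_objective K g dg \<gamma> (df t (x t)) (\<lambda>k. Q k t) (x (t - 1)) (\<alpha> t) (yt t))
      (\<lambda>z. z \<in> simplex d) (xt (Suc t))" using xt_step[OF t] by simp
  note pxt = prox_step[OF t ypos this]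
  have loss: "scalar_prod (df t (x t)) z - scalar_prod (df t (x t)) (xt (Suc t)) \<le> 2 * F"
    "scalar_prod (df (t - 1) (x (t - 1))) (xt (Suc t)) - scalar_prod (df (t - 1) (x (t - 1))) (x t)
      \<le> 2 * F"
    by (intro loss_term_bound x_simplex z pxt(1))+
  have "\<alpha> t * ((norm1 (xt (Suc t) - x t))\<^sup>2 / 2) \<le> \<alpha> t * KL (xt (Suc t)) (x t)"
    "\<alpha> t * ((norm1 (x t - yt t))\<^sup>2 / 2) \<le> \<alpha> t * KL (x t) (yt t)"
    using \<alpha>_lower(1)[OF t] pinsker[OF pxt(1) px(1,2)] pinsker[OF px(1) yt_simplex[OF t]] ypos
    by (auto intro!: mult_left_mono)
  thus ?thesis using loss px(3)[OF pxt(1)] pxt(3)[OF z] unfolding right_diff_distrib by linarith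
qed

lemma xt_pos:
  assumes t: "1 \<le> t" and i: "i < d"
  shows "0 < xt t $ i"
proof (cases "t = 1")
  case True
  thus ?thesis using xt_init i by (simp add: ones_def)
next
  case False
  hence t': "1 \<le> t - 1" using t by simp
  show ?thesis using prox_step(2)[OF t' _ xt_step[OF t'] i] yt_floor(3)[OF t'] t by simp
qed

section \<open>Drift of the queues\<close>

text \<open>The squared distance is carried along with the divergence because the negative square of
  \<open>xt (Suc t) - x t\<close> that round \<open>t\<close> leaves behind pays for the linearisation error of round \<open>Suc t\<close>.\<close>

definition potential :: "nat \<Rightarrow> real" where
  "potential t = KL xs (yt t) + (norm1 (xt t - x (t - 1)))\<^sup>2 / 2"

lemma norm1_sq_le_4: "u \<in> simplex d \<Longrightarrow> v \<in> simplex d \<Longrightarrow> (norm1 (u - v))\<^sup>2 \<le> 4"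
  using power_mono[OF simplex_diameter[of u d v] norm1_nonneg, of 2] by simp

lemma potential_bounds:
  assumes t: "1 \<le> t"
  shows "0 \<le> potential t" "potential t \<le> ln (real d * real T) + 2"
proof -
  show "0 \<le> potential t"
    using KL_nonneg[OF xs yt_simplex[OF t] yt_floor(3)[OF t]] by (simp add: potential_def)
  have "KL xs (yt t) \<le> ln (1 / (\<nu> / real d))"
    using \<nu>_bounds d_ge_1 yt_floor(1)[OF t] by (intro KL_le_ln_inverse_floor[OF xs]) auto
  thus "potential t \<le> ln (real d * real T) + 2"
    using norm1_sq_le_4[OF xt_simplex[OF t] x_simplex[of "t - 1"]]
    by (simp add: potential_def \<nu> mult.commute)
qed

lemma KL_mixing_loss:
  assumes t: "1 \<le> t"
  shows "KL xs (yt t) \<le> KL xs (xt t) + 2 * \<nu>"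
proof -
  have "KL xs (yt t) \<le> KL xs (xt t) + ln (1 / (1 - \<nu>))"
    using \<nu>_bounds xt_pos[OF t] yt_floor(2)[OF t]
    by (intro KL_second_argument_decrease[OF xs]) auto
  moreover have "ln (1 / (1 - \<nu>)) \<le> 1 / (1 - \<nu>) - 1"
    using \<nu>_bounds by (intro ln_le_minus_one) auto
  moreover have "1 / (1 - \<nu>) - 1 \<le> 2 * \<nu>"
  proof -
    have "\<nu> * \<nu> \<le> \<nu> * (1 / 2)" using \<nu>_bounds by (intro mult_left_mono) auto
    thus ?thesis using \<nu>_bounds by (simp add: field_simps)
  qed
  ultimately show ?thesis by linarith
qed

text \<open>Smoothness bounds \<open>g (x t)\<close> by its linearisation at \<open>x (t - 1)\<close>, and convexity bounds the
  linearisation at the Slater point by \<open>- \<sigma>\<close>. Multipliers are nonnegative, so both bounds survive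
  the weighted sum.\<close>

lemma linearised_constraints:
  assumes t: "1 \<le> t"
  shows "\<gamma> * (\<Sum>k=1..K. multiplier k t * g k (x t))
    \<le> - \<gamma> * \<sigma> * (\<Sum>k=1..K. multiplier k t) + (penalty t (x t) - penalty t xs)
      + 3 / 4 * (\<gamma> * L\<^sub>g * (\<Sum>k=1..K. multiplier k t)) * (norm1 (x t - x (t - 1)))\<^sup>2"
proof -
  let ?w = "x (t - 1)" and ?N = "(norm1 (x t - x (t - 1)))\<^sup>2"
  have g_le: "g k (x t) \<le> - \<sigma> + (scalar_prod (dg k ?w) (x t) - scalar_prod (dg k ?w) xs) + 3 / 4 * L\<^sub>g * ?N"
    if k: "k \<in> {1..K}" for k
  proof -
    have "g k (x t) \<le> g k ?w + scalar_prod (dg k ?w) (x t - ?w) + 3 / 4 * L\<^sub>g * ?N"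
      by (rule smooth_convex_upper_bound[OF g_convex[OF k] g_grad[OF k] g_smooth[OF k] x_simplex x_simplex])
    moreover have "g k ?w + scalar_prod (dg k ?w) (xs - ?w) \<le> g k xs"
      by (rule gradient_inequality[OF g_convex[OF k] g_grad[OF k x_simplex] x_simplex xs])
    moreover have "scalar_prod (dg k ?w) (u - ?w) = scalar_prod (dg k ?w) u - scalar_prod (dg k ?w) ?w"
      if "u \<in> simplex d" for u
      by (rule scalar_prod_minus_distrib[OF dg_carrier[OF k x_simplex] simplexD(1)[OF that] simplexD(1)[OF x_simplex]])
    ultimately show ?thesis using slater_point[OF k] x_simplex[of t] xs by fastforce
  qed
  have pen: "(\<Sum>k=1..K. multiplier k t * (\<gamma> * scalar_prod (dg k ?w) u)) = penalty t u"
    if "u \<in> simplex d" for u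
    unfolding penalty_def
    by (intro sum.cong refl)
      (simp add: smult_scalar_prod_distrib[OF dg_carrier[OF _ x_simplex] simplexD(1)[OF that]])
  have "(\<Sum>k=1..K. multiplier k t * g k (x t)) \<le> (\<Sum>k=1..K. multiplier k t *
      (- \<sigma> + (scalar_prod (dg k ?w) (x t) - scalar_prod (dg k ?w) xs) + 3 / 4 * L\<^sub>g * ?N))"
    by (intro sum_mono mult_left_mono g_le multiplier_nonneg[OF t])
  hence "\<gamma> * (\<Sum>k=1..K. multiplier k t * g k (x t)) \<le> \<gamma> * (\<Sum>k=1..K. multiplier k t *
      (- \<sigma> + (scalar_prod (dg k ?w) (x t) - scalar_prod (dg k ?w) xs) + 3 / 4 * L\<^sub>g * ?N))"
    using \<gamma> by (intro mult_left_mono) auto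
  also have "\<dots> = (\<Sum>k=1..K. - \<gamma> * \<sigma> * multiplier k t
      + (multiplier k t * (\<gamma> * scalar_prod (dg k ?w) (x t)) - multiplier k t * (\<gamma> * scalar_prod (dg k ?w) xs))
      + 3 / 4 * (\<gamma> * L\<^sub>g * multiplier k t) * ?N)"
    by (simp add: sum_distrib_left algebra_simps)
  also have "\<dots> = - \<gamma> * \<sigma> * (\<Sum>k=1..K. multiplier k t)
      + ((\<Sum>k=1..K. multiplier k t * (\<gamma> * scalar_prod (dg k ?w) (x t)))
        - (\<Sum>k=1..K. multiplier k t * (\<gamma> * scalar_prod (dg k ?w) xs)))
      + 3 / 4 * (\<gamma> * L\<^sub>g * (\<Sum>k=1..K. multiplier k t)) * ?N"
    by (simp only: sum.distrib sum_subtractf sum_distrib_left sum_distrib_right)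
  finally show ?thesis by (simp only: pen x_simplex xs)
qed

lemma multiplier_sum_near_total_queue:
  "\<bar>(\<Sum>k=1..K. multiplier k t) - total_queue t\<bar> \<le> \<gamma> * G"
proof -
  have "\<bar>(\<Sum>k=1..K. multiplier k t) - total_queue t\<bar> = \<gamma> * \<bar>\<Sum>k=1..K. g k (x (t - 1))\<bar>"
    using \<gamma> by (simp add: multiplier_def sum.distrib sum_distrib_left[symmetric] abs_mult)
  also have "\<dots> \<le> \<gamma> * G"
    using \<gamma> by (intro mult_left_mono order_trans[OF sum_abs g_bound[OF x_simplex]]) auto
  finally show ?thesis .
qed

text \<open>The path from \<open>x (t - 1)\<close> to \<open>x t\<close> runs through \<open>xt t\<close> and \<open>yt t\<close>. The middle piece is at most \<open>2 \<nu>\<close>;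
  as all pieces are bounded, it costs only a multiple of \<open>\<nu>\<close>, and the factor \<open>2\<close> is spent on the
  outer two pieces.\<close>

lemma movement_bound:
  assumes t: "1 \<le> t"
  shows "(norm1 (x t - x (t - 1)))\<^sup>2
    \<le> 2 * (norm1 (x t - yt t))\<^sup>2 + 2 * (norm1 (xt t - x (t - 1)))\<^sup>2 + 20 * \<nu>"
proof -
  define a where "a = norm1 (x t - yt t)"
  define b where "b = norm1 (yt t - xt t)"
  define c where "c = norm1 (xt t - x (t - 1))"
  note sx = x_simplex[of t] x_simplex[of "t - 1"] xt_simplex[OF t] yt_simplex[OF t]
  note cx = sx[THEN simplexD(1)]
  have bounds: "0 \<le> a" "a \<le> 2" "0 \<le> b" "b \<le> 2 * \<nu>" "0 \<le> c" "c \<le> 2"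
    unfolding a_def b_def c_def using sx yt_near_xt[OF t]
    by (auto intro: norm1_nonneg simplex_diameter)
  have "norm1 (x t - x (t - 1)) \<le> a + b + c"
    using norm1_diff_triangle[OF cx(1,4,2)] norm1_diff_triangle[OF cx(4,3,2)]
    by (simp add: a_def b_def c_def)
  hence "(norm1 (x t - x (t - 1)))\<^sup>2 \<le> (a + b + c)\<^sup>2"
    by (intro power_mono norm1_nonneg)
  also have "\<dots> = (a + c)\<^sup>2 + b * (2 * (a + c) + b)"
    by (simp add: power2_eq_square algebra_simps)
  also have "(a + c)\<^sup>2 \<le> 2 * a\<^sup>2 + 2 * c\<^sup>2"
    using zero_le_power2[of "a - c"] by (simp add: power2_eq_square algebra_simps)
  also have "b * (2 * (a + c) + b) \<le> (2 * \<nu>) * 9"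
    using bounds \<nu>_bounds by (intro mult_mono) auto
  finally show ?thesis using \<nu>_bounds by (simp add: a_def c_def)
qed

text \<open>The quadratic terms balance exactly: \<open>3 / 4\<close> from smoothness, \<open>1 / 3\<close> from the step size and
  \<open>2\<close> from the movement multiply to the \<open>1 / 2\<close> that Pinsker's inequality provides.\<close>

lemma step_drift:
  assumes t: "1 \<le> t"
  shows "energy (Suc t) - energy t \<le> - \<gamma> * \<sigma> * total_queue t + \<gamma>\<^sup>2 * (\<sigma> * G + 2 * G\<^sup>2 + 4 * F)
      + \<alpha> t * (potential t - potential (Suc t) + 7 * \<nu>)"
proof -
  define \<Lambda> where "\<Lambda> = (\<Sum>k=1..K. multiplier k t)"
  have \<Lambda>: "total_queue t - \<gamma> * G \<le> \<Lambda>" "\<Lambda> \<le> total_queue t + \<gamma> * G"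
    using multiplier_sum_near_total_queue[of t] unfolding \<Lambda>_def by linarith+
  let ?N = "(norm1 (x t - x (t - 1)))\<^sup>2" and ?a = "(norm1 (x t - yt t))\<^sup>2"
    and ?c = "(norm1 (xt t - x (t - 1)))\<^sup>2" and ?e = "(norm1 (xt (Suc t) - x t))\<^sup>2"
  have "\<gamma> * L\<^sub>g * \<Lambda> \<le> \<gamma> * L\<^sub>g * (total_queue t + \<gamma> * G)"
    using \<Lambda> \<gamma> L\<^sub>g_nonneg by (intro mult_left_mono) auto
  hence "\<gamma> * L\<^sub>g * \<Lambda> \<le> \<alpha> t / 3" using \<alpha>_lower(2)[OF t] by linarith
  hence "\<gamma> * L\<^sub>g * \<Lambda> * ?N \<le> \<alpha> t / 3 * ?N" by (rule mult_right_mono) simp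
  also have "\<dots> \<le> \<alpha> t / 3 * (2 * ?a + 2 * ?c + 20 * \<nu>)"
    using \<alpha>_lower(1)[OF t] by (intro mult_left_mono movement_bound[OF t]) auto
  finally have quad: "3 / 4 * (\<gamma> * L\<^sub>g * \<Lambda>) * ?N \<le> \<alpha> t * (?a / 2 + ?c / 2 + 5 * \<nu>)"
    by (simp add: algebra_simps)
  have "\<gamma> * (\<Sum>k=1..K. multiplier k t * g k (x t))
      \<le> - \<gamma> * \<sigma> * \<Lambda> + 4 * F + \<alpha> t * (KL xs (yt t) - KL xs (xt (Suc t)) - ?e / 2 - ?a / 2)
        + \<alpha> t * (?a / 2 + ?c / 2 + 5 * \<nu>)"
    using linearised_constraints[OF t] mirror_prox_gap[OF t xs] quad unfolding \<Lambda>_def[symmetric]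
    by linarith
  also have "\<dots> = - \<gamma> * \<sigma> * \<Lambda> + 4 * F
      + \<alpha> t * (KL xs (yt t) - KL xs (xt (Suc t)) + ?c / 2 - ?e / 2 + 5 * \<nu>)"
    by (simp add: algebra_simps)
  also have "\<alpha> t * (KL xs (yt t) - KL xs (xt (Suc t)) + ?c / 2 - ?e / 2 + 5 * \<nu>)
      \<le> \<alpha> t * (potential t - potential (Suc t) + 7 * \<nu>)"
    using \<alpha>_lower(1)[OF t] KL_mixing_loss[of "Suc t"]
    by (intro mult_left_mono) (auto simp: potential_def)
  also have "- \<gamma> * \<sigma> * \<Lambda> \<le> - \<gamma> * \<sigma> * total_queue t + \<gamma>\<^sup>2 * (\<sigma> * G)"
  proof -
    have "\<gamma> * \<sigma> * (total_queue t - \<gamma> * G) \<le> \<gamma> * \<sigma> * \<Lambda>"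
      using \<Lambda> \<gamma> \<sigma> by (intro mult_left_mono) auto
    thus ?thesis by (simp add: power2_eq_square algebra_simps)
  qed
  also have "4 * F \<le> \<gamma>\<^sup>2 * (4 * F)"
    using \<gamma> F_nonneg mult_right_mono[of 1 "\<gamma>\<^sup>2" "4 * F"] by (simp add: one_le_power)
  finally show ?thesis using energy_drift[of t] by (simp add: algebra_simps)
qed

text \<open>Summation by parts for the nondecreasing weights \<open>\<alpha>\<close>, in the form of an induction: the partial
  sums are at most \<open>\<alpha>\<close> times the distance of the current potential from its upper bound, and
  this distance is nonnegative, so \<open>\<alpha>\<close> may be increased.\<close>

lemma window_drift:
  fixes m :: real
  assumes s: "1 \<le> s" and m: "\<And>i. i \<le> n \<Longrightarrow> m \<le> total_queue (s + i)"
  defines "C \<equiv> \<sigma> * G + 2 * G\<^sup>2 + 4 * F"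
  shows "energy (s + Suc n) - energy s \<le> real (Suc n) * (- \<gamma> * \<sigma> * m + \<gamma>\<^sup>2 * C)
      + \<alpha> (s + n) * (ln (real d * real T) + 2 - potential (s + Suc n) + 7 * real (Suc n) * \<nu>)"
  using m
proof (induction n)
  have step: "energy (Suc t) - energy t \<le> - \<gamma> * \<sigma> * m + \<gamma>\<^sup>2 * C
      + \<alpha> t * (potential t - potential (Suc t) + 7 * \<nu>)" if "1 \<le> t" "m \<le> total_queue t" for t
  proof -
    have "\<gamma> * \<sigma> * m \<le> \<gamma> * \<sigma> * total_queue t" using that \<gamma> \<sigma> by (intro mult_left_mono) auto
    thus ?thesis using step_drift[OF that(1)] unfolding C_def by linarith
  qed
  let ?B = "ln (real d * real T) + 2"
  {
    case 0
    have "\<alpha> s * (potential s - potential (Suc s) + 7 * \<nu>) \<le> \<alpha> s * (?B - potential (Suc s) + 7 * \<nu>)"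
      using potential_bounds[OF s] \<alpha>_lower(1)[OF s] by (intro mult_left_mono) auto
    thus ?case using step[OF s] 0[of 0] by simp
  next
    case (Suc n)
    let ?t = "s + Suc n"
    have t: "1 \<le> ?t" by simp
    let ?D = "?B - potential ?t + 7 * real (Suc n) * \<nu>"
    have IH: "energy ?t - energy s \<le> real (Suc n) * (- \<gamma> * \<sigma> * m + \<gamma>\<^sup>2 * C) + \<alpha> (s + n) * ?D"
      using Suc by simp
    have "\<alpha> (s + n) * ?D \<le> \<alpha> ?t * ?D"
      using \<alpha>_mono[of "s + n"] s potential_bounds[OF t] \<nu>_bounds by (intro mult_right_mono) auto
    hence "energy (Suc ?t) - energy s \<le> real (Suc n) * (- \<gamma> * \<sigma> * m + \<gamma>\<^sup>2 * C) + \<alpha> ?t * ?D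
        + (- \<gamma> * \<sigma> * m + \<gamma>\<^sup>2 * C + \<alpha> ?t * (potential ?t - potential (Suc ?t) + 7 * \<nu>))"
      using IH step[OF t Suc.prems[of "Suc n"]] by linarith
    also have "\<dots> = real (Suc (Suc n)) * (- \<gamma> * \<sigma> * m + \<gamma>\<^sup>2 * C)
        + \<alpha> ?t * (?B - potential (Suc ?t) + 7 * real (Suc (Suc n)) * \<nu>)"
      by (simp add: algebra_simps)
    finally show ?case by simp
  }
qed

section \<open>The peak of the queues\<close>

text \<open>The peak is taken in the Euclidean norm because the energy is monotone in it.\<close>

definition queue_norm :: "nat \<Rightarrow> real" where
  "queue_norm t = L2_set (\<lambda>k. Q k t) {1..K}"

lemma queue_norm_nonneg: "0 \<le> queue_norm t"
  by (simp add: queue_norm_def)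

lemma queue_le_norm: "k \<in> {1..K} \<Longrightarrow> Q k t \<le> queue_norm t"
  unfolding queue_norm_def by (rule member_le_L2_set) auto

lemma queue_norm_le_total: "queue_norm t \<le> total_queue t"
  unfolding queue_norm_def by (rule L2_set_le_sum) (rule queue_nonneg)

lemma total_queue_le_norm: "total_queue t \<le> real K * queue_norm t"
  using sum_bounded_above[of "{1..K}" "\<lambda>k. Q k t" "queue_norm t"] queue_le_norm by simp

lemma energy_eq_norm: "energy t = (queue_norm t)\<^sup>2 / 2"
  by (simp add: queue_norm_def L2_set_def sum_nonneg)

lemma total_queue_linear: "total_queue n \<le> real n * (\<gamma> * G)"
  using total_queue_lipschitz[of 0 n] Q_init by simp

text \<open>The constant \<open>9\<close> in \<open>l\<close> collects the \<open>2\<close> from the bound on the potential and \<open>7\<close> from the mixing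
  losses \<open>7 \<nu>\<close> of at most \<open>T = 1 / \<nu>\<close> rounds. The condition on \<open>n\<close> makes half of the drift absorb
  the part of \<open>\<alpha> l\<close> that grows with the peak.\<close>

lemma peak_bound:
  fixes n :: nat
  defines "l \<equiv> ln (real d * real T) + 9"
    and "A \<equiv> 3 * L\<^sub>f\<^sup>2 + 6 * L\<^sub>g * G + 3 * H\<^sup>2 + 2"
    and "C \<equiv> \<sigma> * G + 2 * G\<^sup>2 + 4 * F"
  assumes n: "1 \<le> n" "6 * L\<^sub>g * real K * l \<le> \<sigma> * real n"
    and j: "1 \<le> j" "j \<le> Suc T"
    and peak: "\<And>i. 1 \<le> i \<Longrightarrow> i \<le> Suc T \<Longrightarrow> queue_norm i \<le> queue_norm j"
  shows "\<sigma> * queue_norm j \<le> 2 * \<gamma> * (real n * \<sigma> * G + C + A * l)"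
proof -
  define M where "M = queue_norm j"
  have l: "0 \<le> l"
  proof -
    have "1 * 1 \<le> real d * real T" using d_ge_1 T by (intro mult_mono) auto
    thus ?thesis by (simp add: l_def)
  qed
  have nn: "0 \<le> C" "0 \<le> A * l" "0 \<le> M"
    using G_nonneg F_nonneg \<sigma> L\<^sub>g_nonneg l queue_norm_nonneg by (auto simp: C_def A_def M_def)
  show ?thesis
  proof (cases "j \<le> Suc n")
    \<comment> \<open>So early the queues have had no time to grow beyond the claimed bound.\<close>
    case True
    have "M \<le> real j * (\<gamma> * G)"
      unfolding M_def using queue_norm_le_total total_queue_linear order_trans by blast
    also have "\<dots> \<le> (2 * real n) * (\<gamma> * G)"
      using True n \<gamma> G_nonneg by (intro mult_right_mono) auto
    finally have "\<sigma> * M \<le> \<sigma> * ((2 * real n) * (\<gamma> * G))" using \<sigma> by (intro mult_left_mono) auto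
    also have "\<dots> = 2 * \<gamma> * (real n * \<sigma> * G)" by simp
    also have "\<dots> \<le> 2 * \<gamma> * (real n * \<sigma> * G + C + A * l)"
      using nn \<gamma> by (intro mult_left_mono) auto
    finally show ?thesis by (simp add: M_def)
  next
    case False
    define s where "s = j - n"
    obtain n' where n': "n = Suc n'" using n(1) by (cases n) auto
    have s: "1 \<le> s" "j = s + Suc n'" using False n' by (auto simp: s_def)
    define m where "m = M - real n * (\<gamma> * G)"
    have "m \<le> total_queue (s + i)" if i: "i \<le> n'" for i
    proof -
      have "\<bar>total_queue j - total_queue (s + i)\<bar> \<le> real (n - i) * (\<gamma> * G)"
        using total_queue_lipschitz[of "s + i" "n - i"] i s n' by simp
      also have "\<dots> \<le> real n * (\<gamma> * G)"
        using \<gamma> G_nonneg by (intro mult_right_mono) auto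
      finally show ?thesis using queue_norm_le_total[of j] unfolding m_def M_def by linarith
    qed
    from window_drift[OF s(1) this]
    have "energy j - energy s \<le> real n * (- \<gamma> * \<sigma> * m + \<gamma>\<^sup>2 * C)
        + \<alpha> (s + n') * (ln (real d * real T) + 2 - potential j + 7 * real n * \<nu>)"
      unfolding C_def n' s(2) .
    moreover have "0 \<le> energy j - energy s"
    proof -
      have "queue_norm s \<le> queue_norm j" using peak[of s] s j by simp
      hence "(queue_norm s)\<^sup>2 \<le> (queue_norm j)\<^sup>2" by (intro power_mono queue_norm_nonneg)
      thus ?thesis unfolding energy_eq_norm by simp
    qed
    moreover have "\<alpha> (s + n') * (ln (real d * real T) + 2 - potential j + 7 * real n * \<nu>)
        \<le> (A * \<gamma>\<^sup>2 + 3 * \<gamma> * L\<^sub>g * (real K * M)) * l"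
    proof (rule order_trans)
      have "real n \<le> real T" using False j by simp
      hence "7 * real n * \<nu> \<le> 7" using T by (simp add: \<nu> divide_le_eq)
      thus "\<alpha> (s + n') * (ln (real d * real T) + 2 - potential j + 7 * real n * \<nu>) \<le> \<alpha> (s + n') * l"
        using potential_bounds(1)[OF j(1)] \<alpha>_lower(1)[of "s + n'"] s(1)
        by (intro mult_left_mono) (auto simp: l_def)
      have "total_queue i \<le> real K * M" if "1 \<le> i" "i \<le> s + n'" for i
        using order_trans[OF total_queue_le_norm mult_left_mono[OF peak]] that s j
        by (simp add: M_def)
      hence "\<alpha> (s + n') \<le> A * \<gamma>\<^sup>2 + 3 * \<gamma> * L\<^sub>g * (real K * M)"
        unfolding A_def using s(1) by (intro \<alpha>_upper) auto
      thus "\<alpha> (s + n') * l \<le> (A * \<gamma>\<^sup>2 + 3 * \<gamma> * L\<^sub>g * (real K * M)) * l"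
        using l by (rule mult_right_mono)
    qed
    ultimately have "0 \<le> real n * (- \<gamma> * \<sigma> * m + \<gamma>\<^sup>2 * C)
        + (A * \<gamma>\<^sup>2 + 3 * \<gamma> * L\<^sub>g * (real K * M)) * l" by linarith
    also have "\<dots> = - (real n * \<gamma> * (\<sigma> * M)) + \<gamma>\<^sup>2 * (real n * (real n * \<sigma> * G + C) + A * l)
        + \<gamma> * M / 2 * (6 * L\<^sub>g * real K * l)"
      by (simp add: m_def power2_eq_square algebra_simps)
    also have "\<gamma> * M / 2 * (6 * L\<^sub>g * real K * l) \<le> \<gamma> * M / 2 * (\<sigma> * real n)"
      using n nn \<gamma> by (intro mult_left_mono) auto
    also have "\<gamma>\<^sup>2 * (real n * (real n * \<sigma> * G + C) + A * l)
        \<le> \<gamma>\<^sup>2 * (real n * (real n * \<sigma> * G + C) + real n * (A * l))"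
      using n(1) nn mult_right_mono[of 1 "real n" "A * l"] by (intro mult_left_mono) auto
    finally have "(real n * \<gamma>) * (\<sigma> * M) \<le> (real n * \<gamma>) * (2 * \<gamma> * (real n * \<sigma> * G + C + A * l))"
      by (simp add: power2_eq_square algebra_simps)
    thus ?thesis using n(1) \<gamma> by (simp add: M_def)
  qed
qed

lemma violation_bound:
  fixes n :: nat
  defines "l \<equiv> ln (real d * real T) + 9"
    and "A \<equiv> 3 * L\<^sub>f\<^sup>2 + 6 * L\<^sub>g * G + 3 * H\<^sup>2 + 2"
    and "C \<equiv> \<sigma> * G + 2 * G\<^sup>2 + 4 * F"
  assumes n: "1 \<le> n" "6 * L\<^sub>g * real K * l \<le> \<sigma> * real n" and k: "k \<in> {1..K}"
  shows "\<sigma> * (\<Sum>t=1..T. g k (x t)) \<le> 2 * (real n * \<sigma> * G + C + A * l)"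
proof -
  let ?J = "{1..Suc T}"
  have "Max (queue_norm ` ?J) \<in> queue_norm ` ?J" by (intro Max_in) auto
  then obtain j where j: "j \<in> ?J" "queue_norm j = Max (queue_norm ` ?J)" by (metis imageE)
  have peak: "queue_norm i \<le> queue_norm j" if "1 \<le> i" "i \<le> Suc T" for i
    using that unfolding j(2) by (intro Max_ge) auto
  have "\<gamma> * (\<Sum>t=1..T. g k (x t)) \<le> queue_norm j"
    using violation_le_queue[OF k, of T] queue_le_norm[OF k, of "Suc T"] peak[of "Suc T"] by simp
  hence "\<sigma> * (\<gamma> * (\<Sum>t=1..T. g k (x t))) \<le> \<sigma> * queue_norm j"
    using \<sigma> by (intro mult_left_mono) auto
  also have "\<dots> \<le> 2 * \<gamma> * (real n * \<sigma> * G + C + A * l)"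
    unfolding C_def A_def l_def
    using n j peak unfolding l_def by (intro peak_bound) auto
  finally have "\<gamma> * (\<sigma> * (\<Sum>t=1..T. g k (x t))) \<le> \<gamma> * (2 * (real n * \<sigma> * G + C + A * l))"
    by (simp add: algebra_simps)
  thus ?thesis using \<gamma> by simp
qed

text \<open>Up to rounding, \<open>n\<close> is the shortest window that \<open>violation_bound\<close> permits. Every monomial that
  then occurs is a product of at most four parameters, hence at most the fourth power of one plus
  their sum.\<close>

lemma violation_explicit:
  assumes k: "k \<in> {1..K}"
  shows "(\<Sum>t=1..T. g k (x t))
    \<le> 418 * (1 + H + F + G + L\<^sub>f + L\<^sub>g + real K + 1 / \<sigma>) ^ 4 * ((1 + ln (real d)) * ln (real T))"
proof -
  define i where "i = 1 / \<sigma>"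
  define S where "S = 1 + H + F + G + L\<^sub>f + L\<^sub>g + real K + i"
  define W where "W = (1 + ln (real d)) * ln (real T)"
  define l where "l = ln (real d * real T) + 9"
  define A where "A = 3 * L\<^sub>f\<^sup>2 + 6 * L\<^sub>g * G + 3 * H\<^sup>2 + 2"
  define C where "C = \<sigma> * G + 2 * G\<^sup>2 + 4 * F"
  define V where "V = (\<Sum>t=1..T. g k (x t))"
  have i: "0 < i" using \<sigma> by (simp add: i_def)
  have nn: "0 \<le> H" "0 \<le> F" "0 \<le> G" "0 \<le> L\<^sub>f" "0 \<le> L\<^sub>g" "0 \<le> real K" "0 \<le> i"
    using H Hk_nonneg F_nonneg G_nonneg L\<^sub>f_nonneg L\<^sub>g_nonneg i by (auto intro: sum_nonneg)
  have le_S: "1 \<le> S" "H \<le> S" "F \<le> S" "G \<le> S" "L\<^sub>f \<le> S" "L\<^sub>g \<le> S" "real K \<le> S" "i \<le> S"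
    using nn by (auto simp: S_def)
  \<comment> \<open>Shorter products are padded with factors 1, which are at most S.\<close>
  have monomial: "a * b * c * e \<le> S ^ 4"
    if "0 \<le> a" "a \<le> S" "0 \<le> b" "b \<le> S" "0 \<le> c" "c \<le> S" "0 \<le> e" "e \<le> S" for a b c e
  proof -
    have "a * b * c * e \<le> S * S * S * S" using that by (intro mult_mono mult_nonneg_nonneg) auto
    thus ?thesis by (simp add: power4_eq_xxxx)
  qed
  have lnT: "1 \<le> ln (real T)"
  proof -
    have "exp 1 \<le> real T" using T exp_le by linarith
    thus ?thesis using T by (simp add: ln_ge_iff)
  qed
  have lnd: "0 \<le> ln (real d)" using d_ge_1 by simp
  have W1: "1 \<le> W" and lW: "0 \<le> l" "l \<le> 10 * W"
  proof -
    have "l = ln (real d) + ln (real T) + 9" using d_ge_1 T by (simp add: l_def ln_mult)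
    moreover have "ln (real d) \<le> ln (real d) * ln (real T)"
      using lnd lnT mult_left_mono[of 1 "ln (real T)" "ln (real d)"] by simp
    ultimately show "1 \<le> W" "0 \<le> l" "l \<le> 10 * W"
      using lnd lnT by (simp_all add: W_def distrib_right)
  qed
  \<comment> \<open>The successor guarantees a nonempty window.\<close>
  define n where "n = Suc (nat \<lceil>6 * L\<^sub>g * real K * l * i\<rceil>)"
  have "0 \<le> 6 * L\<^sub>g * real K * l * i" using nn lW by simp
  hence n_le: "real n \<le> 6 * L\<^sub>g * real K * l * i + 2"
    and n_ge: "6 * L\<^sub>g * real K * l * i \<le> real n"
    unfolding n_def by linarith+
  have "6 * L\<^sub>g * real K * l \<le> \<sigma> * real n" using n_ge \<sigma> by (simp add: i_def field_simps)
  hence "\<sigma> * V \<le> 2 * (real n * \<sigma> * G + C + A * l)"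
    unfolding V_def C_def A_def l_def by (intro violation_bound k) (auto simp: n_def)
  hence "V \<le> 2 * (real n * G + C * i + A * l * i)" using \<sigma> by (simp add: i_def field_simps)
  also have "C * i = G + 2 * (G * G * i * 1) + 4 * (F * i * 1 * 1)"
    using \<sigma> by (simp add: C_def i_def power2_eq_square field_simps)
  also have "real n * G \<le> (6 * L\<^sub>g * real K * l * i + 2) * G" using n_le nn by (intro mult_right_mono)
  finally have "V \<le> 2 * ((6 * L\<^sub>g * real K * l * i + 2) * G
      + (G + 2 * (G * G * i * 1) + 4 * (F * i * 1 * 1)) + A * l * i)" by simp
  also have "\<dots> = 12 * (L\<^sub>g * real K * i * G) * l + 6 * (G * 1 * 1 * 1) + 4 * (G * G * i * 1)
      + 8 * (F * i * 1 * 1) + 2 * (3 * (L\<^sub>f * L\<^sub>f * i * 1) + 6 * (L\<^sub>g * G * i * 1)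
      + 3 * (H * H * i * 1) + 2 * (i * 1 * 1 * 1)) * l"
    by (simp add: A_def power2_eq_square algebra_simps)
  also have "\<dots> \<le> 12 * S ^ 4 * l + 6 * S ^ 4 + 4 * S ^ 4 + 8 * S ^ 4
      + 2 * (3 * S ^ 4 + 6 * S ^ 4 + 3 * S ^ 4 + 2 * S ^ 4) * l"
    by (intro add_mono mult_right_mono mult_left_mono monomial nn le_S lW(1)) (use le_S in auto)
  also have "\<dots> = 40 * S ^ 4 * l + 18 * S ^ 4" by simp
  also have "\<dots> \<le> 40 * S ^ 4 * (10 * W) + 18 * S ^ 4 * W"
    using lW W1 le_S(1) by (intro add_mono mult_left_mono) (auto simp: mult_le_cancel_left1)
  also have "\<dots> = 418 * S ^ 4 * W" by simp
  finally show ?thesis unfolding V_def S_def W_def i_def .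
qed

end

section \<open>The universal polynomial\<close>

lemma eval_mpoly_superset:
  assumes "finite A" "Poly_Mapping.keys P \<subseteq> A"
  shows "eval_mpoly P vs = (\<Sum>m\<in>A. Poly_Mapping.lookup P m *
      (\<Prod>i\<in>Poly_Mapping.keys m. (vs ! i) ^ Poly_Mapping.lookup m i))"
  unfolding eval_mpoly_def using assms
  by (intro sum.mono_neutral_left) (auto simp: in_keys_iff)

lemma eval_mpoly_add: "eval_mpoly (P + R) vs = eval_mpoly P vs + eval_mpoly R vs"
proof -
  let ?A = "Poly_Mapping.keys P \<union> Poly_Mapping.keys R"
  have "Poly_Mapping.keys (P + R) \<subseteq> ?A" by (rule Poly_Mapping.keys_add)
  thus ?thesis
    by (simp add: eval_mpoly_superset[of ?A] lookup_add distrib_right sum.distrib)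
qed

lemma nonneg_mpoly_add:
  assumes "nonneg_mpoly n P" "nonneg_mpoly n R"
  shows "nonneg_mpoly n (P + R)"
proof -
  have nn: "0 \<le> Poly_Mapping.lookup P m" "0 \<le> Poly_Mapping.lookup R m" for m
    using assms by (cases "m \<in> Poly_Mapping.keys P"; cases "m \<in> Poly_Mapping.keys R";
        auto simp: nonneg_mpoly_def in_keys_iff)+
  show ?thesis
    using assms Poly_Mapping.keys_add[of P R] nn
    unfolding nonneg_mpoly_def by (auto simp: lookup_add)
qed

definition scaled_power :: "real \<Rightarrow> nat \<Rightarrow> nat \<Rightarrow> real_mpoly" where
  "scaled_power c i e = Poly_Mapping.single (Poly_Mapping.single i e) c"

lemma eval_scaled_power: "eval_mpoly (scaled_power c i e) vs = c * (vs ! i) ^ e"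
  by (simp add: eval_mpoly_def scaled_power_def)

lemma nonneg_scaled_power: "0 \<le> c \<Longrightarrow> i < n \<Longrightarrow> nonneg_mpoly n (scaled_power c i e)"
  by (simp add: nonneg_mpoly_def scaled_power_def)

lemma add_power4_le:
  fixes a b :: real
  shows "(a + b) ^ 4 \<le> 8 * (a ^ 4 + b ^ 4)"
proof -
  have sq: "(u + v)\<^sup>2 \<le> 2 * (u\<^sup>2 + v\<^sup>2)" for u v :: real
    using zero_le_power2[of "u - v"] by (simp add: power2_eq_square algebra_simps)
  have "(a + b) ^ 4 = ((a + b)\<^sup>2)\<^sup>2" by simp
  also have "\<dots> \<le> (2 * (a\<^sup>2 + b\<^sup>2))\<^sup>2" by (intro power_mono sq) auto
  also have "\<dots> = 4 * (a\<^sup>2 + b\<^sup>2)\<^sup>2" by (simp only: power_mult_distrib) simp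
  also have "\<dots> \<le> 4 * (2 * ((a\<^sup>2)\<^sup>2 + (b\<^sup>2)\<^sup>2))" by (intro mult_left_mono sq) auto
  finally show ?thesis by simp
qed

lemma sum8_power4_le:
  fixes a b c e p q r s :: real
  shows "(a + b + c + e + p + q + r + s) ^ 4
    \<le> 512 * (a ^ 4 + b ^ 4 + c ^ 4 + e ^ 4 + p ^ 4 + q ^ 4 + r ^ 4 + s ^ 4)"
proof -
  have "(a + b + c + e + p + q + r + s) ^ 4 = (((a + b) + (c + e)) + ((p + q) + (r + s))) ^ 4"
    by (simp add: add.assoc)
  thus ?thesis
    using add_power4_le[of a b] add_power4_le[of c e] add_power4_le[of p q] add_power4_le[of r s]
      add_power4_le[of "a + b" "c + e"] add_power4_le[of "p + q" "r + s"]
      add_power4_le[of "(a + b) + (c + e)" "(p + q) + (r + s)"] by argo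
qed

text \<open>By convexity of the fourth power, the fourth power of a sum of eight terms is at most \<open>512\<close>
  times the sum of their fourth powers. So a polynomial without mixed monomials is enough, with
  coefficients \<open>418 * 512 = 214016\<close>.\<close>

definition violation_polynomial :: real_mpoly where
  "violation_polynomial = scaled_power 214016 0 0 + (scaled_power 214016 0 4 +
    (scaled_power 214016 1 4 + (scaled_power 214016 2 4 + (scaled_power 214016 3 4 +
    (scaled_power 214016 4 4 + (scaled_power 214016 5 4 + scaled_power 214016 6 4))))))"

lemma nonneg_violation_polynomial: "nonneg_mpoly 7 violation_polynomial"
  unfolding violation_polynomial_def by (intro nonneg_mpoly_add nonneg_scaled_power) auto

text \<open>A supremum of squares is nonnegative only if it is a genuine supremum; boundedness comes from
  the bound on the gradients.\<close>

lemma V_inf_nonneg: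
  assumes "simplex_oco d K f df g dg F L\<^sub>f G Hk L\<^sub>g" and xs: "xs \<in> simplex d"
  shows "0 \<le> V_inf d df T"
proof -
  interpret simplex_oco d K f df g dg F L\<^sub>f G Hk L\<^sub>g by (rule assms(1))
  have carrier: "df t w \<in> carrier_vec d" if "w \<in> simplex d" for t w
    using f_grad[OF that, of t] simplexD(2)[OF that] by (simp add: has_gradient_on_def)
  have ni: "0 \<le> norm_inf (df t w - df s w) \<and> norm_inf (df t w - df s w) \<le> 2 * F"
    if w: "w \<in> simplex d" for t s w
  proof
    let ?v = "df t w - df s w"
    have dim: "dim_vec (df t w) = d" "dim_vec (df s w) = d" using carrier[OF w] by auto
    show "0 \<le> norm_inf ?v"
      by (rule order_trans[OF abs_ge_zero norm_inf_coord[of 0]]) (use dim d_ge_1 in simp)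
    have "\<bar>?v $ i\<bar> \<le> 2 * F" if i: "i < d" for i
      using norm_inf_coord[of i "df t w"] norm_inf_coord[of i "df s w"] f_bound[OF w, of t]
        f_bound[OF w, of s] dim i by simp
    thus "norm_inf ?v \<le> 2 * F"
      unfolding norm_inf_def using dim d_ge_1 by (subst Max_le_iff) (auto simp: lessThan_empty_iff)
  qed
  have "0 \<le> (SUP w\<in>simplex d. (norm_inf (df t w - df (t - 1) w))\<^sup>2)" for t
  proof (rule cSUP_upper2[OF _ xs])
    show "bdd_above ((\<lambda>w. (norm_inf (df t w - df (t - 1) w))\<^sup>2) ` simplex d)"
      using ni by (intro bdd_aboveI2[of _ _ "(2 * F)\<^sup>2"] power_mono) auto
  qed simp
  thus ?thesis by (simp add: V_inf_def sum_nonneg)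
qed

lemma violation_polynomial_dominates:
  "418 * (1 + H + F + G + L + L' + k + i) ^ 4
    \<le> eval_mpoly violation_polynomial [H, F, G, L, L', k, i]"
  using sum8_power4_le[of 1 H F G L L' k i]
  by (simp add: violation_polynomial_def eval_mpoly_add eval_scaled_power)

theorem theorem6p2:
  shows "\<exists>P :: real_mpoly. nonneg_mpoly 7 P \<and>
    (\<forall>(T :: nat) (d :: nat) (K :: nat)
       (f :: nat \<Rightarrow> real vec \<Rightarrow> real) (df :: nat \<Rightarrow> real vec \<Rightarrow> real vec)
       (g :: nat \<Rightarrow> real vec \<Rightarrow> real) (dg :: nat \<Rightarrow> real vec \<Rightarrow> real vec)
       (F :: real) (L\<^sub>f :: real) (G :: real) (Hk :: nat \<Rightarrow> real) (L\<^sub>g :: real) (H :: real) (\<sigma> :: real)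
       (\<eta> :: real) (\<gamma> :: real) (\<nu> :: real) (\<xi> :: nat \<Rightarrow> real) (\<alpha> :: nat \<Rightarrow> real)
       (x :: nat \<Rightarrow> real vec) (xt :: nat \<Rightarrow> real vec) (yt :: nat \<Rightarrow> real vec)
       (Q :: nat \<Rightarrow> nat \<Rightarrow> real).
       T > 2 \<longrightarrow> d \<ge> 1 \<longrightarrow>
       simplex_oco d K f df g dg F L\<^sub>f G Hk L\<^sub>g \<longrightarrow>
       slater d K g \<sigma> \<longrightarrow>
       H = (\<Sum>k=1..K. Hk k) \<longrightarrow>
       \<eta> = (V_inf d df T + L\<^sub>f\<^sup>2 + 1) powr (- 1 / 2) \<longrightarrow>
       \<gamma> = (V_inf d df T + L\<^sub>f\<^sup>2 + 1) powr (1 / 4) \<longrightarrow>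
       \<nu> = 1 / real T \<longrightarrow>
       (\<forall>t\<ge>1. \<xi> t = \<gamma> * L\<^sub>g * (\<Sum>k=1..K. \<bar>Q k t\<bar>) + \<gamma>\<^sup>2 * (L\<^sub>g * G + H\<^sup>2)) \<longrightarrow>
       \<alpha> 0 = 0 \<longrightarrow>
       (\<forall>t\<ge>1. \<alpha> t = max (3 * (\<eta> * L\<^sub>f\<^sup>2 + \<gamma>\<^sup>2 * L\<^sub>g * G) + 2 / \<eta> + 3 * \<xi> t) (\<alpha> (t - 1))) \<longrightarrow>
       mirror_prox_run d K df g dg \<gamma> \<nu> \<alpha> x xt yt Q \<longrightarrow>
       (\<forall>k\<in>{1..K}. (\<Sum>t=1..T. g k (x t))
          \<le> eval_mpoly P [H, F, G, L\<^sub>f, L\<^sub>g, real K, 1 / \<sigma>] * (1 + ln (real d)) * ln (real T)))"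
proof (rule exI[of _ violation_polynomial], intro conjI allI impI ballI)
  show "nonneg_mpoly 7 violation_polynomial" by (rule nonneg_violation_polynomial)
next
  fix T d K :: nat and f df g dg F L\<^sub>f G Hk L\<^sub>g H \<sigma> \<eta> \<gamma> \<nu> \<xi> \<alpha> x xt yt Q k
  assume T: "2 < T" and oco: "simplex_oco d K f df g dg F L\<^sub>f G Hk L\<^sub>g" and sl: "slater d K g \<sigma>"
    and H: "H = (\<Sum>k=1..K. Hk k)"
    and \<eta>: "\<eta> = (V_inf d df T + L\<^sub>f\<^sup>2 + 1) powr (- 1 / 2)"
    and \<gamma>: "\<gamma> = (V_inf d df T + L\<^sub>f\<^sup>2 + 1) powr (1 / 4)"
    and \<nu>: "\<nu> = 1 / real T"
    and \<xi>: "\<forall>t\<ge>1. \<xi> t = \<gamma> * L\<^sub>g * (\<Sum>k=1..K. \<bar>Q k t\<bar>) + \<gamma>\<^sup>2 * (L\<^sub>g * G + H\<^sup>2)"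
    and \<alpha>: "\<alpha> 0 = 0"
      "\<forall>t\<ge>1. \<alpha> t = max (3 * (\<eta> * L\<^sub>f\<^sup>2 + \<gamma>\<^sup>2 * L\<^sub>g * G) + 2 / \<eta> + 3 * \<xi> t) (\<alpha> (t - 1))"
    and run: "mirror_prox_run d K df g dg \<gamma> \<nu> \<alpha> x xt yt Q" and k: "k \<in> {1..K}"
  obtain xs where xs: "xs \<in> simplex d" "\<And>k. k \<in> {1..K} \<Longrightarrow> g k xs \<le> - \<sigma>" and \<sigma>: "0 < \<sigma>"
    using sl unfolding slater_def by blast
  define B where "B = V_inf d df T + L\<^sub>f\<^sup>2 + 1"
  have B: "1 \<le> B" using V_inf_nonneg[OF oco xs(1), of T] by (simp add: B_def)
  have \<gamma>1: "1 \<le> \<gamma>" using B unfolding \<gamma> B_def[symmetric] by (intro ge_one_powr_ge_zero) auto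
  have "\<gamma>\<^sup>2 = B powr (1 / 2)"
    using B unfolding \<gamma> B_def[symmetric] by (simp add: power2_eq_square powr_add[symmetric])
  hence \<eta>\<gamma>: "\<eta> = 1 / \<gamma>\<^sup>2"
    unfolding \<eta> B_def[symmetric] by (simp add: powr_minus_divide)
  interpret primal_dual_run d K f df g dg F L\<^sub>f G Hk L\<^sub>g \<gamma> \<nu> \<alpha> x xt yt Q T H \<eta> \<sigma> \<xi> xs
    using oco run T H \<gamma>1 \<eta>\<gamma> \<nu> \<xi> \<alpha> \<sigma> xs
    by (intro primal_dual_run.intro primal_dual_run_axioms.intro) auto
  have "0 \<le> (1 + ln (real d)) * ln (real T)" using d_ge_1 T by simp
  hence "418 * (1 + H + F + G + L\<^sub>f + L\<^sub>g + real K + 1 / \<sigma>) ^ 4 * ((1 + ln (real d)) * ln (real T))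
      \<le> eval_mpoly violation_polynomial [H, F, G, L\<^sub>f, L\<^sub>g, real K, 1 / \<sigma>]
        * ((1 + ln (real d)) * ln (real T))"
    by (intro mult_right_mono violation_polynomial_dominates)
  thus "(\<Sum>t=1..T. g k (x t)) \<le> eval_mpoly violation_polynomial [H, F, G, L\<^sub>f, L\<^sub>g, real K, 1 / \<sigma>]
      * (1 + ln (real d)) * ln (real T)"
    using violation_explicit[OF k] by (simp only: mult.assoc)
qed

end
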